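(* Let $\mathbb{F}$ be a field with $\operatorname{char}\mathbb{F}\neq 2$. For the split Albert algebra $\mathcal{A}=H_3(\mathbb{O}_s)$ over $\mathbb{F}$, with unit $1$, we have $$\mathscr{P}(\mathcal{A})=(\mathcal{A}\setminus\mathbb{F}1)\cup\{0,1\},\qquad w(\mathcal{A})\le 10.$$ If $\mathbb{F}$ is quadratically closed, then $w(\mathcal{A})\le 7$.
   Context: $\mathbb{O}_s$ is the eight-dimensional split octonion algebra over $\mathbb{F}$ with its standard conjugation $a\mapsto\bar a$; concretely, one may take $\mathbb{O}_s=M_2(\mathbb{F})\oplus M_2(\mathbb{F})$ with $(a,b)(c,d)=(ac+\bar d\,b,\ da+b\,\bar c)$ and $\overline{(a,b)}=(\bar a,-b)$, where for $a\in M_2(\mathbb{F})$, $\bar a=\operatorname{tr}(a)I_2-a$. The split Albert algebra is $$\mathcal{A}=H_3(\mathbb{O}_s)=\left\{\begin{bmatrix}\alpha&a&b\\ \bar a&\beta&c\\ \bar b&\bar c&\gamma\end{bmatrix}:\alpha,\beta,\gamma\in\mathbb{F},\ a,b,c\in\mathbb{O}_s\right\}$$ with Jordan product $X\circ Y=\frac12(XY+YX)$, where $XY$ is the usual matrix product with octonion entries; its unit is $1=I_3$ and it has dimension $27$. A field of characteristic $\neq2$ is quadratically closed if every polynomial of degree two over it has a root in it (equivalently, every element is a square). Idempotent words: let $\mathcal{J}$ be a unital Jordan algebra with product $\circ$. An idempotent is $e\in\mathcal{J}$ with $e\circ e=e$. An idempotent word of length $m\ge 1$ is a left-nested product $(\cdots((e_1\circ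 e_2)\circ e_3)\circ\cdots)\circ e_m$ with all $e_i$ idempotents (for $m=1$ it is $e_1$). $\mathscr{P}(\mathcal{J})$ is the set of all values of idempotent words. For $x\in\mathscr{P}(\mathcal{J})$, $\ell_{\mathcal{J}}(x)$ is the minimal length of an idempotent word with value $x$, and $w(\mathcal{J})=\sup_{x\in\mathscr{P}(\mathcal{J})}\ell_{\mathcal{J}}(x)$. *)

theory Defs
  imports
    "HOL-Analysis.Analysis"
    "HOL-Computational_Algebra.Polynomial"
    "HOL-Library.Extended_Nat"
begin

section \<open>Quadratically closed fields\<close>

definition quadratically_closed :: "'a::field itself \<Rightarrow> bool" where
  "quadratically_closed (_ :: 'a itself) \<longleftrightarrow>
     (\<forall>p :: 'a poly. degree p = 2 \<longrightarrow> (\<exists>x. poly p x = 0))"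


section \<open>Idempotent words\<close>

text \<open>
  A (Jordan) algebra enters only through its carrier \<open>A\<close> and its product \<open>p\<close>.
\<close>

definition idempotents :: "'b set \<Rightarrow> ('b \<Rightarrow> 'b \<Rightarrow> 'b) \<Rightarrow> 'b set" where
  "idempotents A p = {e \<in> A. p e e = e}"

definition idempotent_word :: "'b set \<Rightarrow> ('b \<Rightarrow> 'b \<Rightarrow> 'b) \<Rightarrow> 'b list \<Rightarrow> bool" where
  "idempotent_word A p es \<longleftrightarrow> es \<noteq> [] \<and> set es \<subseteq> idempotents A p"

text \<open>The left-nested product of a nonempty list; \<open>word_value p [e] = e\<close>.\<close>

definition word_value :: "('b \<Rightarrow> 'b \<Rightarrow> 'b) \<Rightarrow> 'b list \<Rightarrow> 'b" where
  "word_value p es = foldl p (hd es) (tl es)"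

definition idempotent_word_values :: "'b set \<Rightarrow> ('b \<Rightarrow> 'b \<Rightarrow> 'b) \<Rightarrow> 'b set" where
  "idempotent_word_values A p = {word_value p es |es. idempotent_word A p es}"

text \<open>Only meaningful for \<open>x \<in> idempotent_word_values A p\<close>.\<close>

definition idempotent_word_length :: "'b set \<Rightarrow> ('b \<Rightarrow> 'b \<Rightarrow> 'b) \<Rightarrow> 'b \<Rightarrow> nat" where
  "idempotent_word_length A p x =
     (LEAST m. \<exists>es. idempotent_word A p es \<and> word_value p es = x \<and> length es = m)"

definition idempotent_width :: "'b set \<Rightarrow> ('b \<Rightarrow> 'b \<Rightarrow> 'b) \<Rightarrow> enat" where
  "idempotent_width A p =
     (SUP x\<in>idempotent_word_values A p. enat (idempotent_word_length A p x))"


section \<open>Split octonions\<close>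

text \<open>
  The Cayley--Dickson double of the algebra of 2 by 2 matrices. Addition, negation and zero are
  those of the product type; the multiplication is nonassociative.
\<close>

type_synonym 'a oct = "('a^2^2) \<times> ('a^2^2)"

definition mat2_conj :: "'a::field^2^2 \<Rightarrow> 'a^2^2" where
  "mat2_conj a = mat (trace a) - a"

fun oct_mult :: "'a::field oct \<Rightarrow> 'a oct \<Rightarrow> 'a oct" (infixl \<open>\<star>\<close> 70) where
  "(a, b) \<star> (c, d) = (a ** c + mat2_conj d ** b, d ** a + b ** mat2_conj c)"

fun oct_conj :: "'a::field oct \<Rightarrow> 'a oct" where
  "oct_conj (a, b) = (mat2_conj a, - b)"

definition oct_of_scalar :: "'a::field \<Rightarrow> 'a oct" where
  "oct_of_scalar \<alpha> = (mat \<alpha>, 0)"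

fun oct_scale :: "'a::field \<Rightarrow> 'a oct \<Rightarrow> 'a oct" where
  "oct_scale \<alpha> (a, b) = (map_matrix ((*) \<alpha>) a, map_matrix ((*) \<alpha>) b)"


section \<open>The split Albert algebra\<close>

type_synonym 'a octmat = "('a oct)^3^3"

definition albert :: "'a::field octmat set" where
  "albert =
     {vector [vector [oct_of_scalar \<alpha>, a, b],
              vector [oct_conj a, oct_of_scalar \<beta>, c],
              vector [oct_conj b, oct_conj c, oct_of_scalar \<gamma>]] |\<alpha> \<beta> \<gamma> a b c. True}"

text \<open>The matrix product of the library requires an associative ring of entries.\<close>

definition octmat_mult :: "'a::field octmat \<Rightarrow> 'a octmat \<Rightarrow> 'a octmat" where
  "octmat_mult X Y = (\<chi> i j. \<Sum>k\<in>UNIV. X$i$k \<star> Y$k$j)"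

definition octmat_scale :: "'a::field \<Rightarrow> 'a octmat \<Rightarrow> 'a octmat" where
  "octmat_scale \<alpha> X = map_matrix (oct_scale \<alpha>) X"

definition albert_mult :: "'a::field octmat \<Rightarrow> 'a octmat \<Rightarrow> 'a octmat" where
  "albert_mult X Y = octmat_scale (1 / 2) (octmat_mult X Y + octmat_mult Y X)"

text \<open>
  The identity matrix; the constant \<open>1\<close> of the vector type would be the all-ones array.
\<close>

definition albert_one :: "'a::field octmat" where
  "albert_one = mat (oct_of_scalar 1)"

end

theory Submission
  imports Defs
begin

text \<open>
  Write an element of the Albert algebra as \<open>Herm \<alpha> \<beta> \<gamma> a b c\<close>, with \<open>a\<close>, \<open>b\<close>, \<open>c\<close> the
  entries in positions 12, 13 and 23. Both width bounds come from one fact: every nonscalar element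
  is a word of length at most seven (\<open>short_word_nonscalar\<close>).
  
  Three observations drive the construction. First, the set of words of given length is invariant
  under automorphisms. The available ones are the two index transpositions and, for each octonion
  \<open>u\<close> of norm zero, a shear \<open>shear12 u\<close>, which is conjugation by a unipotent matrix supported on the
  first two indices. Second, multiplying by a diagonal idempotent such as \<open>diag(1,1,0)\<close> forgets
  the entry 33 and halves the entries 13 and 23; read backwards, an element whose entry 33 is zero is
  a product \<open>y \<circ> e\<close> in which the entry 33 of \<open>y\<close> is at our disposal. Third, the octonions are split,
  so a shear parameter \<open>u\<close> of norm zero with any prescribed inner product with a given nonzero
  octonion exists; no equation ever has to be solved by extracting a square root.
  
  The count is as follows. Call an element a row if it vanishes outside its first row and column.
  A row whose off-diagonal entries are not both of norm zero is a word of length three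
  (\<open>short_word_row\<close>). An element \<open>z\<close> with zero diagonal is a word of length six: if some
  off-diagonal norm is nonzero, freeing two diagonal entries and choosing them well makes \<open>z\<close>
  conjugate to a row (\<open>short_word_to_row\<close>); otherwise a shear makes some norm nonzero, or else the
  whole diagonal is freed, set to \<open>(-1, 1, 0)\<close>, and the null off-diagonal entries are then removed by
  shears (\<open>short_word_null_offdiag\<close>). Finally, a nonscalar element is conjugate to one with a zero
  diagonal entry; freeing this entry, it can be given trace zero, and then it is conjugate to an
  element with zero diagonal. This gives length seven.
  
  Conversely, suppose that a scalar \<open>\<alpha>\<close> is a product \<open>y \<circ> e\<close> with \<open>e\<close> a nonscalar idempotent. The
  trace form is associative, so computing the trace of \<open>(y \<circ> e) \<circ> e = y \<circ> (e \<circ> e)\<close> in two ways gives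
  \<open>\<alpha> tr(e) = 3 \<alpha>\<close>. A nonscalar idempotent has trace 1 or 2, hence \<open>\<alpha> = 0\<close>. If the last letter is
  scalar it is 0 or 1, and induction on the length of the word applies.
\<close>

section \<open>Split octonions\<close>

definition oct_norm :: "'a::field oct \<Rightarrow> 'a" where
  "oct_norm x = det (fst x) - det (snd x)"

definition oct_inner :: "'a::field oct \<Rightarrow> 'a oct \<Rightarrow> 'a" where
  "oct_inner x y =
     fst x$1$1 * fst y$2$2 + fst x$2$2 * fst y$1$1 - fst x$1$2 * fst y$2$1 - fst x$2$1 * fst y$1$2
   - snd x$1$1 * snd y$2$2 - snd x$2$2 * snd y$1$1 + snd x$1$2 * snd y$2$1 + snd x$2$1 * snd y$1$2"

text \<open>
  The identities of octonion arithmetic used below are polynomial identities in the eight matrix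
  entries of each argument, and are verified as such.
\<close>

lemma oct_eq_iff:
  fixes x y :: "'a::field oct"
  shows "x = y \<longleftrightarrow>
    fst x$1$1 = fst y$1$1 \<and> fst x$1$2 = fst y$1$2 \<and> fst x$2$1 = fst y$2$1 \<and> fst x$2$2 = fst y$2$2 \<and>
    snd x$1$1 = snd y$1$1 \<and> snd x$1$2 = snd y$1$2 \<and> snd x$2$1 = snd y$2$1 \<and> snd x$2$2 = snd y$2$2"
  by (auto simp: prod_eq_iff vec_eq_iff forall_2)

lemma mat2_conj_coords:
  "mat2_conj a$1$1 = a$2$2" "mat2_conj a$1$2 = - a$1$2"
  "mat2_conj a$2$1 = - a$2$1" "mat2_conj a$2$2 = a$1$1"
  by (simp_all add: mat2_conj_def mat_def trace_def sum_2)

lemma oct_mult_coords: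
  fixes x y :: "'a::field oct"
  shows
  "fst (x \<star> y)$1$1 = fst x$1$1 * fst y$1$1 + fst x$1$2 * fst y$2$1 + snd y$2$2 * snd x$1$1 - snd y$1$2 * snd x$2$1"
  "fst (x \<star> y)$1$2 = fst x$1$1 * fst y$1$2 + fst x$1$2 * fst y$2$2 + snd y$2$2 * snd x$1$2 - snd y$1$2 * snd x$2$2"
  "fst (x \<star> y)$2$1 = fst x$2$1 * fst y$1$1 + fst x$2$2 * fst y$2$1 - snd y$2$1 * snd x$1$1 + snd y$1$1 * snd x$2$1"
  "fst (x \<star> y)$2$2 = fst x$2$1 * fst y$1$2 + fst x$2$2 * fst y$2$2 - snd y$2$1 * snd x$1$2 + snd y$1$1 * snd x$2$2"
  "snd (x \<star> y)$1$1 = snd y$1$1 * fst x$1$1 + snd y$1$2 * fst x$2$1 + snd x$1$1 * fst y$2$2 - snd x$1$2 * fst y$2$1"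
  "snd (x \<star> y)$1$2 = snd y$1$1 * fst x$1$2 + snd y$1$2 * fst x$2$2 - snd x$1$1 * fst y$1$2 + snd x$1$2 * fst y$1$1"
  "snd (x \<star> y)$2$1 = snd y$2$1 * fst x$1$1 + snd y$2$2 * fst x$2$1 + snd x$2$1 * fst y$2$2 - snd x$2$2 * fst y$2$1"
  "snd (x \<star> y)$2$2 = snd y$2$1 * fst x$1$2 + snd y$2$2 * fst x$2$2 - snd x$2$1 * fst y$1$2 + snd x$2$2 * fst y$1$1"
  by (cases x; cases y; simp add: matrix_matrix_mult_def sum_2 mat2_conj_coords)+

lemma oct_conj_coords:
  fixes x :: "'a::field oct"
  shows "fst (oct_conj x)$1$1 = fst x$2$2" "fst (oct_conj x)$1$2 = - fst x$1$2"
  "fst (oct_conj x)$2$1 = - fst x$2$1" "fst (oct_conj x)$2$2 = fst x$1$1"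
  "snd (oct_conj x) = - snd x"
  by (cases x; simp add: mat2_conj_coords)+

lemma oct_scale_coords:
  fixes x :: "'a::field oct"
  shows "fst (oct_scale r x)$i$j = r * fst x$i$j" "snd (oct_scale r x)$i$j = r * snd x$i$j"
  by (cases x; simp add: map_matrix_def)+

lemma oct_of_scalar_coords:
  "fst (oct_of_scalar r)$1$1 = r" "fst (oct_of_scalar r)$1$2 = 0"
  "fst (oct_of_scalar r)$2$1 = 0" "fst (oct_of_scalar r)$2$2 = r"
  "snd (oct_of_scalar r) = 0"
  by (simp_all add: oct_of_scalar_def mat_def)

lemmas oct_coords = oct_eq_iff oct_mult_coords oct_conj_coords oct_scale_coords
  oct_of_scalar_coords oct_norm_def oct_inner_def det_2

lemma oct_mult_add: "x \<star> (y + z) = x \<star> y + x \<star> z" "(x + y) \<star> z = x \<star> z + y \<star> z"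
  and oct_mult_diff: "x \<star> (y - z) = x \<star> y - x \<star> z" "(x - y) \<star> z = x \<star> z - y \<star> z"
  and oct_mult_minus: "x \<star> (- y) = - (x \<star> y)" "(- x) \<star> y = - (x \<star> y)"
  and oct_mult_zero: "x \<star> 0 = 0" "0 \<star> x = 0"
  and oct_mult_scale: "x \<star> oct_scale r y = oct_scale r (x \<star> y)" "oct_scale r x \<star> y = oct_scale r (x \<star> y)"
  by (simp_all add: oct_coords algebra_simps)

lemma oct_scale_add: "oct_scale r (x + y) = oct_scale r x + oct_scale r y"
  "oct_scale (r + s) x = oct_scale r x + oct_scale s x"
  and oct_scale_diff: "oct_scale r (x - y) = oct_scale r x - oct_scale r y"
  "oct_scale (r - s) x = oct_scale r x - oct_scale s x"
  and oct_scale_minus: "oct_scale r (- x) = - oct_scale r x" "oct_scale (- r) x = - oct_scale r x"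
  and oct_scale_zero: "oct_scale r 0 = 0" "oct_scale 0 x = 0"
  and oct_scale_one: "oct_scale 1 x = x"
  and oct_scale_scale: "oct_scale r (oct_scale s x) = oct_scale (r * s) x"
  by (simp_all add: oct_coords algebra_simps)

lemma oct_conj_add: "oct_conj (x + y) = oct_conj x + oct_conj y"
  and oct_conj_diff: "oct_conj (x - y) = oct_conj x - oct_conj y"
  and oct_conj_minus: "oct_conj (- x) = - oct_conj x"
  and oct_conj_zero: "oct_conj 0 = 0"
  and oct_conj_scale: "oct_conj (oct_scale r x) = oct_scale r (oct_conj x)"
  and oct_conj_conj: "oct_conj (oct_conj x) = x"
  and oct_conj_mult: "oct_conj (x \<star> y) = oct_conj y \<star> oct_conj x"
  by (simp_all add: oct_coords algebra_simps)

lemma oct_inner_add: "oct_inner x (y + z) = oct_inner x y + oct_inner x z"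
  "oct_inner (x + y) z = oct_inner x z + oct_inner y z"
  and oct_inner_diff: "oct_inner x (y - z) = oct_inner x y - oct_inner x z"
  "oct_inner (x - y) z = oct_inner x z - oct_inner y z"
  and oct_inner_minus: "oct_inner x (- y) = - oct_inner x y" "oct_inner (- x) y = - oct_inner x y"
  and oct_inner_zero: "oct_inner x 0 = 0" "oct_inner 0 x = 0"
  and oct_inner_scale: "oct_inner x (oct_scale r y) = r * oct_inner x y"
  "oct_inner (oct_scale r x) y = r * oct_inner x y"
  and oct_inner_commute: "oct_inner x y = oct_inner y x"
  and oct_inner_conj: "oct_inner (oct_conj x) (oct_conj y) = oct_inner x y"
  and oct_inner_self: "oct_inner x x = 2 * oct_norm x"
  by (simp_all add: oct_coords algebra_simps)

lemmas oct_linear = oct_mult_add oct_mult_diff oct_mult_minus oct_mult_zero oct_mult_scale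
  oct_scale_add oct_scale_diff oct_scale_minus oct_scale_zero oct_scale_one oct_scale_scale
  oct_conj_add oct_conj_diff oct_conj_minus oct_conj_zero oct_conj_scale oct_conj_conj
  oct_inner_add oct_inner_diff oct_inner_minus oct_inner_zero oct_inner_scale

lemma oct_norm_add: "oct_norm (x + y) = oct_norm x + oct_norm y + oct_inner x y"
  and oct_norm_diff: "oct_norm (x - y) = oct_norm x + oct_norm y - oct_inner x y"
  and oct_norm_minus: "oct_norm (- x) = oct_norm x"
  and oct_norm_zero: "oct_norm 0 = 0"
  and oct_norm_scale: "oct_norm (oct_scale r x) = r\<^sup>2 * oct_norm x"
  and oct_norm_conj: "oct_norm (oct_conj x) = oct_norm x"
  by (simp_all add: oct_coords algebra_simps power2_eq_square)

lemma oct_norm_mult: "oct_norm (x \<star> y) = oct_norm x * oct_norm y"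
  by (simp add: oct_coords algebra_simps)

lemma oct_left_cancel: "x \<star> (oct_conj x \<star> y) = oct_scale (oct_norm x) y"
  "oct_conj x \<star> (x \<star> y) = oct_scale (oct_norm x) y"
  and oct_right_cancel: "(y \<star> x) \<star> oct_conj x = oct_scale (oct_norm x) y"
  "(y \<star> oct_conj x) \<star> x = oct_scale (oct_norm x) y"
  by (simp_all add: oct_coords algebra_simps)

lemma oct_left_cancel_polar:
  "x \<star> (oct_conj y \<star> z) + y \<star> (oct_conj x \<star> z) = oct_scale (oct_inner x y) z"
  "oct_conj x \<star> (y \<star> z) + oct_conj y \<star> (x \<star> z) = oct_scale (oct_inner x y) z"
  and oct_right_cancel_polar:
  "(z \<star> x) \<star> oct_conj y + (z \<star> y) \<star> oct_conj x = oct_scale (oct_inner x y) z"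
  by (simp_all add: oct_coords algebra_simps)

lemma oct_inner_mult:
  "oct_inner (x \<star> y) z = oct_inner y (oct_conj x \<star> z)"
  "oct_inner (x \<star> y) z = oct_inner x (z \<star> oct_conj y)"
  by (simp_all add: oct_coords algebra_simps)

lemma oct_inner_mult_left: "oct_inner (x \<star> y) (x \<star> z) = oct_norm x * oct_inner y z"
  by (simp add: oct_coords algebra_simps)

text \<open>
  The middle Moufang identity \<open>(u x)(y u) = u (x y) u\<close>, with the right-hand side expanded by means of
  \<open>u z u = \<langle>u, conj z\<rangle> u - n(u) conj z\<close>. For \<open>u\<close> of norm zero the product is a multiple of \<open>u\<close>.
\<close>

lemma oct_moufang:
  "(u \<star> x) \<star> (y \<star> u) = oct_scale (oct_inner u (oct_conj (x \<star> y))) u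
     - oct_scale (oct_norm u) (oct_conj (x \<star> y))"
  by (simp add: oct_coords algebra_simps)


lemma oct_scale_eq_0_iff: "oct_scale r x = 0 \<longleftrightarrow> r = 0 \<or> x = 0"
  by (auto simp: oct_coords)

lemma oct_conj_eq_0_iff: "oct_conj x = 0 \<longleftrightarrow> x = 0"
  by (auto simp: oct_coords)

lemma oct_mult_eq_0_left: "x \<star> y = 0 \<Longrightarrow> oct_norm x \<noteq> 0 \<Longrightarrow> y = 0"
  using oct_left_cancel(2)[of x y] by (simp add: oct_linear oct_scale_eq_0_iff)

lemma oct_mult_eq_0_right: "x \<star> y = 0 \<Longrightarrow> oct_norm y \<noteq> 0 \<Longrightarrow> x = 0"
  using oct_right_cancel(1)[of x y] by (simp add: oct_linear oct_scale_eq_0_iff)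

lemma oct_scale_cancel_right: "oct_scale r x = oct_scale s x \<longleftrightarrow> r = s \<or> x = 0"
  by (auto simp: oct_coords)

definition oct_of_coords :: "'a \<Rightarrow> 'a \<Rightarrow> 'a \<Rightarrow> 'a \<Rightarrow> 'a \<Rightarrow> 'a \<Rightarrow> 'a \<Rightarrow> 'a \<Rightarrow> 'a::field oct" where
  "oct_of_coords x11 x12 x21 x22 y11 y12 y21 y22 =
    (vector [vector [x11, x12], vector [x21, x22]], vector [vector [y11, y12], vector [y21, y22]])"

text \<open>
  The norm is a hyperbolic form: the eight coordinates pair off so that each coordinate vector is
  null and meets exactly one other. A multiple of the partner of a nonzero coordinate of \<open>d\<close> works.
\<close>

lemma oct_exists_null_inner:
  fixes d :: "'a::field oct"
  assumes "d \<noteq> 0"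
  shows "\<exists>u. oct_norm u = 0 \<and> oct_inner u d = \<tau>"
proof -
  consider "fst d$1$1 \<noteq> 0" | "fst d$1$2 \<noteq> 0" | "fst d$2$1 \<noteq> 0" | "fst d$2$2 \<noteq> 0"
    | "snd d$1$1 \<noteq> 0" | "snd d$1$2 \<noteq> 0" | "snd d$2$1 \<noteq> 0" | "snd d$2$2 \<noteq> 0"
    using assms by (auto simp: oct_eq_iff)
  then show ?thesis
  proof cases
    case 1 then show ?thesis
      by (intro exI[of _ "oct_of_coords 0 0 0 (\<tau> / fst d$1$1) 0 0 0 0"]) (simp add: oct_of_coords_def oct_coords)
  next
    case 2 then show ?thesis
      by (intro exI[of _ "oct_of_coords 0 0 (- \<tau> / fst d$1$2) 0 0 0 0 0"]) (simp add: oct_of_coords_def oct_coords)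
  next
    case 3 then show ?thesis
      by (intro exI[of _ "oct_of_coords 0 (- \<tau> / fst d$2$1) 0 0 0 0 0 0"]) (simp add: oct_of_coords_def oct_coords)
  next
    case 4 then show ?thesis
      by (intro exI[of _ "oct_of_coords (\<tau> / fst d$2$2) 0 0 0 0 0 0 0"]) (simp add: oct_of_coords_def oct_coords)
  next
    case 5 then show ?thesis
      by (intro exI[of _ "oct_of_coords 0 0 0 0 0 0 0 (- \<tau> / snd d$1$1)"]) (simp add: oct_of_coords_def oct_coords)
  next
    case 6 then show ?thesis
      by (intro exI[of _ "oct_of_coords 0 0 0 0 0 0 (\<tau> / snd d$1$2) 0"]) (simp add: oct_of_coords_def oct_coords)
  next
    case 7 then show ?thesis
      by (intro exI[of _ "oct_of_coords 0 0 0 0 0 (\<tau> / snd d$2$1) 0 0"]) (simp add: oct_of_coords_def oct_coords)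
  next
    case 8 then show ?thesis
      by (intro exI[of _ "oct_of_coords 0 0 0 0 (- \<tau> / snd d$2$2) 0 0 0"]) (simp add: oct_of_coords_def oct_coords)
  qed
qed

text \<open>
  The partner of a nonzero coordinate of \<open>d\<close> is used to adjust the inner product, and a second
  hyperbolic plane supplies norm 1.
\<close>

lemma oct_exists_unit_inner:
  fixes d :: "'a::field oct"
  assumes "d \<noteq> 0"
  shows "\<exists>w. oct_norm w = 1 \<and> oct_inner w d = \<tau>"
proof -
  let ?s = "fst d$1$1 + fst d$2$2" and ?t = "fst d$1$2 - fst d$2$1"
  consider "fst d$1$1 \<noteq> 0" | "fst d$1$2 \<noteq> 0" | "fst d$2$1 \<noteq> 0" | "fst d$2$2 \<noteq> 0"
    | "snd d$1$1 \<noteq> 0" | "snd d$1$2 \<noteq> 0" | "snd d$2$1 \<noteq> 0" | "snd d$2$2 \<noteq> 0"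
    using assms by (auto simp: oct_eq_iff)
  then show ?thesis
  proof cases
    case 1 then show ?thesis
      by (intro exI[of _ "oct_of_coords 0 1 (- 1) ((\<tau> - ?t) / fst d$1$1) 0 0 0 0"]) (simp add: oct_of_coords_def oct_coords)
  next
    case 2 then show ?thesis
      by (intro exI[of _ "oct_of_coords 1 0 ((?s - \<tau>) / fst d$1$2) 1 0 0 0 0"]) (simp add: oct_of_coords_def oct_coords)
  next
    case 3 then show ?thesis
      by (intro exI[of _ "oct_of_coords 1 ((?s - \<tau>) / fst d$2$1) 0 1 0 0 0 0"]) (simp add: oct_of_coords_def oct_coords)
  next
    case 4 then show ?thesis
      by (intro exI[of _ "oct_of_coords ((\<tau> - ?t) / fst d$2$2) 1 (- 1) 0 0 0 0 0"]) (simp add: oct_of_coords_def oct_coords)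
  next
    case 5 then show ?thesis
      by (intro exI[of _ "oct_of_coords 1 0 0 1 0 0 0 ((?s - \<tau>) / snd d$1$1)"]) (simp add: oct_of_coords_def oct_coords)
  next
    case 6 then show ?thesis
      by (intro exI[of _ "oct_of_coords 1 0 0 1 0 0 ((\<tau> - ?s) / snd d$1$2) 0"]) (simp add: oct_of_coords_def oct_coords)
  next
    case 7 then show ?thesis
      by (intro exI[of _ "oct_of_coords 1 0 0 1 0 ((\<tau> - ?s) / snd d$2$1) 0 0"]) (simp add: oct_of_coords_def oct_coords)
  next
    case 8 then show ?thesis
      by (intro exI[of _ "oct_of_coords 1 0 0 1 ((?s - \<tau>) / snd d$2$2) 0 0 0"]) (simp add: oct_of_coords_def oct_coords)
  qed
qed

lemma oct_exists_null: "\<exists>u :: 'a::field oct. oct_norm u = 0 \<and> u \<noteq> 0"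
  by (intro exI[of _ "oct_of_coords 1 0 0 0 0 0 0 0"]) (simp add: oct_of_coords_def oct_coords)

section \<open>Words in idempotents\<close>

definition within_words :: "'b set \<Rightarrow> ('b \<Rightarrow> 'b \<Rightarrow> 'b) \<Rightarrow> nat \<Rightarrow> 'b \<Rightarrow> bool" where
  "within_words A p k x \<longleftrightarrow> (\<exists>es. idempotent_word A p es \<and> word_value p es = x \<and> length es \<le> k)"

lemma word_value_snoc: "es \<noteq> [] \<Longrightarrow> word_value p (es @ [e]) = p (word_value p es) e"
  by (simp add: word_value_def)

lemma within_words_idempotent:
  assumes "e \<in> idempotents A p" shows "within_words A p (Suc k) e"
  unfolding within_words_def
  by (rule exI[of _ "[e]"]) (use assms in \<open>simp add: idempotent_word_def word_value_def\<close>)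

lemma within_words_mult:
  assumes "within_words A p k y" "e \<in> idempotents A p"
  shows "within_words A p (Suc k) (p y e)"
proof -
  obtain es where "idempotent_word A p es" "word_value p es = y" "length es \<le> k"
    using assms(1) unfolding within_words_def by blast
  then show ?thesis
    using assms(2) unfolding within_words_def
    by (intro exI[of _ "es @ [e]"]) (auto simp: idempotent_word_def word_value_snoc)
qed

lemma within_words_mono: "within_words A p k x \<Longrightarrow> k \<le> l \<Longrightarrow> within_words A p l x"
  unfolding within_words_def by (blast intro: le_trans)

lemma word_value_map:
  assumes "es \<noteq> []" "set es \<subseteq> A"
    and hom: "\<And>x y. x \<in> A \<Longrightarrow> y \<in> A \<Longrightarrow> f (p x y) = q (f x) (f y)"
    and closed: "\<And>x y. x \<in> A \<Longrightarrow> y \<in> A \<Longrightarrow> p x y \<in> A"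
  shows "word_value p es \<in> A" "word_value q (map f es) = f (word_value p es)"
proof -
  have "word_value p es \<in> A \<and> word_value q (map f es) = f (word_value p es)"
    using assms(1,2)
  proof (induction es rule: rev_nonempty_induct)
    case (snoc e es)
    then show ?case using hom closed by (simp add: word_value_snoc)
  qed (simp add: word_value_def)
  then show "word_value p es \<in> A" "word_value q (map f es) = f (word_value p es)" by simp_all
qed

lemma within_words_image:
  assumes "within_words A p k x"
    and maps: "\<And>x. x \<in> A \<Longrightarrow> f x \<in> B"
    and hom: "\<And>x y. x \<in> A \<Longrightarrow> y \<in> A \<Longrightarrow> f (p x y) = q (f x) (f y)"
    and closed: "\<And>x y. x \<in> A \<Longrightarrow> y \<in> A \<Longrightarrow> p x y \<in> A"
  shows "within_words B q k (f x)"
proof -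
  obtain es where es: "idempotent_word A p es" "word_value p es = x" "length es \<le> k"
    using assms(1) unfolding within_words_def by blast
  then have ne: "es \<noteq> []" "set es \<subseteq> A"
    by (auto simp: idempotent_word_def idempotents_def)
  have "f e \<in> idempotents B q" if "e \<in> idempotents A p" for e
    using that maps hom[of e e] by (simp add: idempotents_def)
  then have "idempotent_word B q (map f es)"
    using es(1) by (auto simp: idempotent_word_def)
  then show ?thesis
    unfolding within_words_def using es word_value_map(2)[of es A f p q] ne hom closed
    by (intro exI[of _ "map f es"]) simp
qed

section \<open>The Albert algebra in coordinates and its automorphisms\<close>

datatype 'a herm = Herm 'a 'a 'a "'a oct" "'a oct" "'a oct"

fun herm_scale :: "'a::field \<Rightarrow> 'a herm \<Rightarrow> 'a herm" where
  "herm_scale r (Herm \<alpha> \<beta> \<gamma> a b c) =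
    Herm (r * \<alpha>) (r * \<beta>) (r * \<gamma>) (oct_scale r a) (oct_scale r b) (oct_scale r c)"

text \<open>
  The anticommutator \<open>XY + YX\<close> of the hermitian matrices. It has no denominators, so polynomial
  identities for it can be checked by ring normalization.
\<close>

fun herm_anticomm :: "'a::field herm \<Rightarrow> 'a herm \<Rightarrow> 'a herm" where
  "herm_anticomm (Herm \<alpha> \<beta> \<gamma> a b c) (Herm \<alpha>' \<beta>' \<gamma>' a' b' c') =
    Herm (2 * (\<alpha> * \<alpha>') + oct_inner a a' + oct_inner b b')
         (2 * (\<beta> * \<beta>') + oct_inner a a' + oct_inner c c')
         (2 * (\<gamma> * \<gamma>') + oct_inner b b' + oct_inner c c')
         (oct_scale (\<alpha> + \<beta>) a' + oct_scale (\<alpha>' + \<beta>') a + b \<star> oct_conj c' + b' \<star> oct_conj c)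
         (oct_scale (\<alpha> + \<gamma>) b' + oct_scale (\<alpha>' + \<gamma>') b + a \<star> c' + a' \<star> c)
         (oct_scale (\<beta> + \<gamma>) c' + oct_scale (\<beta>' + \<gamma>') c + oct_conj a \<star> b' + oct_conj a' \<star> b)"

definition herm_mult :: "'a::field herm \<Rightarrow> 'a herm \<Rightarrow> 'a herm" where
  "herm_mult x y = herm_scale (1/2) (herm_anticomm x y)"

fun swap12 :: "'a::field herm \<Rightarrow> 'a herm" where
  "swap12 (Herm \<alpha> \<beta> \<gamma> a b c) = Herm \<beta> \<alpha> \<gamma> (oct_conj a) c b"

fun swap23 :: "'a::field herm \<Rightarrow> 'a herm" where
  "swap23 (Herm \<alpha> \<beta> \<gamma> a b c) = Herm \<alpha> \<gamma> \<beta> b a (oct_conj c)"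

text \<open>
  For \<open>u\<close> of norm zero this is conjugation by the matrix \<open>g = 1 + u E12 - conj u E21\<close>, for which
  \<open>g g\<^sup>* = 1\<close>. The expected summand \<open>- u (conj a) u\<close> in the entry 12 is written as \<open>- \<langle>u, a\<rangle> u\<close>.
\<close>

fun shear12 :: "'a::field oct \<Rightarrow> 'a herm \<Rightarrow> 'a herm" where
  "shear12 u (Herm \<alpha> \<beta> \<gamma> a b c) =
    Herm (\<alpha> + oct_inner u a) (\<beta> - oct_inner u a) \<gamma>
         (a + oct_scale (\<beta> - \<alpha> - oct_inner u a) u) (b + u \<star> c) (c - oct_conj u \<star> b)"

lemma swap12_hom: "swap12 (herm_mult x y) = herm_mult (swap12 x) (swap12 y)"
  by (cases x; cases y)
    (simp add: herm_mult_def oct_linear oct_conj_mult oct_inner_conj algebra_simps)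

lemma swap23_hom: "swap23 (herm_mult x y) = herm_mult (swap23 x) (swap23 y)"
  by (cases x; cases y)
    (simp add: herm_mult_def oct_linear oct_conj_mult oct_inner_conj algebra_simps)

lemma shear12_scale: "shear12 u (herm_scale r x) = herm_scale r (shear12 u x)"
  by (cases x) (simp add: oct_linear algebra_simps)

text \<open>
  Associativity fails, so invariance of the product is not automatic from \<open>g g\<^sup>* = 1\<close>. All
  entries reduce to the linearized alternative laws, except for the entry 12, where the product of
  two sheared entries \<open>(u c)(conj b' u)\<close> needs the Moufang identity.
\<close>

lemma shear12_hom:
  fixes x y :: "'a::field herm"
  assumes u: "oct_norm u = 0"
  shows "shear12 u (herm_mult x y) = herm_mult (shear12 u x) (shear12 u y)"
proof -
  obtain \<alpha> \<beta> \<gamma> a b c where x: "x = Herm \<alpha> \<beta> \<gamma> a b c" by (cases x)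
  obtain \<alpha>' \<beta>' \<gamma>' a' b' c' where y: "y = Herm \<alpha>' \<beta>' \<gamma>' a' b' c'" by (cases y)
  have uu: "oct_inner u u = 0" "oct_inner (u \<star> p) (u \<star> q) = 0"
    "oct_inner (oct_conj u \<star> p) (oct_conj u \<star> q) = 0"
    "u \<star> (oct_conj u \<star> p) = 0" "oct_conj u \<star> (u \<star> p) = 0" for p q
    by (simp_all add: u oct_inner_self oct_inner_mult_left oct_left_cancel oct_norm_conj oct_linear)
  have swap: "oct_inner a u = oct_inner u a" "oct_inner a' u = oct_inner u a'"
    by (rule oct_inner_commute)+
  have adj: "oct_inner b (u \<star> q) = oct_inner u (b \<star> oct_conj q)"
    "oct_inner (u \<star> q) b' = oct_inner u (b' \<star> oct_conj q)"
    "oct_inner c (oct_conj u \<star> q) = oct_inner u (q \<star> oct_conj c)"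
    "oct_inner (oct_conj u \<star> q) c' = oct_inner u (q \<star> oct_conj c')" for q
    by (simp_all add: oct_coords algebra_simps)
  have moufang: "(u \<star> p) \<star> (oct_conj q \<star> u) = oct_scale (oct_inner u (q \<star> oct_conj p)) u" for p q
    by (simp add: oct_moufang u oct_linear oct_conj_mult)
  have polar: "b' \<star> (oct_conj b \<star> u) = oct_scale (oct_inner b b') u - b \<star> (oct_conj b' \<star> u)"
    "(u \<star> c') \<star> oct_conj c = oct_scale (oct_inner c c') u - (u \<star> c) \<star> oct_conj c'"
    using oct_left_cancel_polar(1)[of b b' u] oct_right_cancel_polar[of u c c']
    by (simp_all add: algebra_simps)
  have polar': "a \<star> (oct_conj u \<star> q) = oct_scale (oct_inner u a) q - u \<star> (oct_conj a \<star> q)"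
    "a' \<star> (oct_conj u \<star> q) = oct_scale (oct_inner u a') q - u \<star> (oct_conj a' \<star> q)"
    "oct_conj a \<star> (u \<star> q) = oct_scale (oct_inner u a) q - oct_conj u \<star> (a \<star> q)"
    "oct_conj a' \<star> (u \<star> q) = oct_scale (oct_inner u a') q - oct_conj u \<star> (a' \<star> q)" for q
    using oct_left_cancel_polar[of u a q] oct_left_cancel_polar[of u a' q]
    by (simp_all add: algebra_simps)
  have "shear12 u (herm_anticomm x y) = herm_anticomm (shear12 u x) (shear12 u y)"
    unfolding x y herm_anticomm.simps shear12.simps herm.inject
  proof (intro conjI, goal_cases)
    case 4 then show ?case
      by (simp add: oct_linear oct_conj_mult moufang polar uu adj swap)
        (simp add: oct_eq_iff oct_scale_coords algebra_simps)
  next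
    case 5 then show ?case
      by (simp add: oct_linear polar' uu algebra_simps)
  next
    case 6 then show ?case
      by (simp add: oct_linear polar' uu algebra_simps)
  qed (simp_all add: oct_linear adj uu swap algebra_simps)
  then show ?thesis
    by (simp add: herm_mult_def shear12_scale)
qed


abbreviation short_word :: "nat \<Rightarrow> 'a::field herm \<Rightarrow> bool" where
  "short_word \<equiv> within_words UNIV herm_mult"

lemma short_word_hom:
  assumes "\<And>x y. f (herm_mult x y) = herm_mult (f x) (f y)" "\<And>x. g (f x) = x"
    "\<And>x y. g (herm_mult x y) = herm_mult (g x) (g y)"
  shows "short_word k (f x) \<longleftrightarrow> short_word k x"
  using within_words_image[of UNIV herm_mult k x f UNIV herm_mult]
    within_words_image[of UNIV herm_mult k "f x" g UNIV herm_mult] assms by auto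

lemma short_word_swap12: "short_word k (swap12 x) \<longleftrightarrow> short_word k x"
proof (rule short_word_hom[of _ swap12])
  show "swap12 (swap12 x) = x" for x :: "'a herm"
    by (cases x) (simp add: oct_conj_conj)
qed (rule swap12_hom)+

lemma short_word_swap23: "short_word k (swap23 x) \<longleftrightarrow> short_word k x"
proof (rule short_word_hom[of _ swap23])
  show "swap23 (swap23 x) = x" for x :: "'a herm"
    by (cases x) (simp add: oct_conj_conj)
qed (rule swap23_hom)+

lemma short_word_shear12:
  assumes "oct_norm u = 0"
  shows "short_word k (shear12 u x) \<longleftrightarrow> short_word k x"
proof (rule short_word_hom[of _ "shear12 (- u)"])
  show "shear12 (- u) (shear12 u x) = x" for x
    using assms by (cases x)
      (simp add: oct_linear oct_inner_self oct_left_cancel oct_norm_conj algebra_simps)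
qed (use assms in \<open>simp_all add: shear12_hom oct_norm_minus\<close>)

lemma herm_idempotent_diag:
  fixes \<alpha> :: "'a::field"
  assumes "(2::'a) \<noteq> 0" "\<alpha> * \<alpha> = \<alpha>" "\<beta> * \<beta> = \<beta>" "\<gamma> * \<gamma> = \<gamma>"
  shows "Herm \<alpha> \<beta> \<gamma> 0 0 0 \<in> idempotents UNIV herm_mult"
  using assms by (simp add: idempotents_def herm_mult_def oct_linear)

text \<open>
  This is \<open>v\<^sup>* v\<close> for the row vector \<open>v = (conj a, 1, c)\<close>; the hypothesis says that it has trace 1.
\<close>

lemma herm_idempotent_rank1:
  fixes a :: "'a::field oct"
  assumes "(2::'a) \<noteq> 0" "oct_norm a + oct_norm c = 0"
  shows "Herm (oct_norm a) 1 (oct_norm c) a (a \<star> c) c \<in> idempotents UNIV herm_mult"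
proof -
  have c: "oct_norm c = - oct_norm a" using assms(2) by (simp add: add_eq_0_iff)
  have double: "x + x = oct_scale 2 x" for x :: "'a oct"
    by (simp add: oct_coords)
  have "herm_anticomm (Herm (oct_norm a) 1 (oct_norm c) a (a \<star> c) c) (Herm (oct_norm a) 1 (oct_norm c) a (a \<star> c) c)
    = herm_scale 2 (Herm (oct_norm a) 1 (oct_norm c) a (a \<star> c) c)"
    by (simp add: c oct_inner_self oct_norm_mult oct_linear oct_left_cancel oct_right_cancel algebra_simps)
       (simp add: double oct_linear)
  then show ?thesis
    using assms(1) by (simp add: idempotents_def herm_mult_def oct_linear)
qed

text \<open>
  These four lemmas are used backwards: to write an element with a vanishing diagonal entry or block
  as a short word, one may first fill in that entry or block at will, at the price of doubling the
  adjacent off-diagonal entries and of one more letter.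
\<close>

lemma short_word_free3:
  fixes \<alpha> :: "'a::field"
  assumes "(2::'a) \<noteq> 0" "short_word k (Herm \<alpha> \<beta> \<gamma> a (oct_scale 2 b) (oct_scale 2 c))"
  shows "short_word (Suc k) (Herm \<alpha> \<beta> 0 a b c)"
  using within_words_mult[OF assms(2) herm_idempotent_diag[of 1 1 0]] assms(1)
  by (simp add: herm_mult_def oct_linear)

lemma short_word_free2:
  fixes \<alpha> :: "'a::field"
  assumes "(2::'a) \<noteq> 0" "short_word k (Herm \<alpha> \<beta> \<gamma> (oct_scale 2 a) b (oct_scale 2 c))"
  shows "short_word (Suc k) (Herm \<alpha> 0 \<gamma> a b c)"
  using within_words_mult[OF assms(2) herm_idempotent_diag[of 1 0 1]] assms(1)
  by (simp add: herm_mult_def oct_linear)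

lemma short_word_free1:
  fixes \<alpha> :: "'a::field"
  assumes "(2::'a) \<noteq> 0" "short_word k (Herm \<alpha> \<beta> \<gamma> (oct_scale 2 a) (oct_scale 2 b) c)"
  shows "short_word (Suc k) (Herm 0 \<beta> \<gamma> a b c)"
  using within_words_mult[OF assms(2) herm_idempotent_diag[of 0 1 1]] assms(1)
  by (simp add: herm_mult_def oct_linear)

lemma short_word_free_block:
  fixes \<alpha> :: "'a::field"
  assumes "(2::'a) \<noteq> 0" "short_word k (Herm \<alpha> \<beta> \<gamma> (oct_scale 2 a) (oct_scale 2 b) c)"
  shows "short_word (Suc k) (Herm \<alpha> 0 0 a b 0)"
  using within_words_mult[OF assms(2) herm_idempotent_diag[of 1 0 0]] assms(1)
  by (simp add: herm_mult_def oct_linear)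

section \<open>Elements concentrated in one row\<close>

text \<open>
  The product of \<open>E22\<close> and a rank one idempotent centred at the second index is
  \<open>Herm 0 1 0 g 0 v\<close> with \<open>n(g) + n(v) = 0\<close>, so it has length two. Shearing it by a null \<open>p\<close> and
  multiplying by \<open>E11\<close> yields the row \<open>\<langle>p, g\<rangle>, (g + (1 - \<langle>p, g\<rangle>) p) / 2, p v / 2\<close>. The parameters
  \<open>p\<close>, \<open>g\<close>, \<open>v\<close> are chosen to hit the given row; taking \<open>p = b w\<close> makes \<open>p v = 2 b\<close> solvable with
  a free summand in \<open>v\<close>, which is used to adjust \<open>n(v)\<close>.
\<close>

lemma short_word_row_null:
  fixes a b :: "'a::field oct"
  assumes two: "(2::'a) \<noteq> 0" and b: "oct_norm b = 0" "b \<noteq> 0" and ab: "oct_conj b \<star> a \<noteq> 0"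
  shows "short_word 3 (Herm \<alpha> 0 0 a b 0)"
proof -
  obtain w where w: "oct_norm w = 1" "oct_inner w (oct_conj b \<star> a) = \<alpha> / 2"
    using oct_exists_unit_inner[OF ab] by blast
  define p where "p = b \<star> w"
  define g where "g = oct_scale 2 a - oct_scale (1 - \<alpha>) p"
  obtain z where z: "oct_norm z = 0" "oct_inner z b = (- oct_norm g - 4) / 2"
    using oct_exists_null_inner[OF b(2)] by blast
  define v where "v = oct_scale 2 (oct_conj w) + oct_conj p \<star> z"
  have z2: "2 * oct_inner z b = - oct_norm g - 4"
    by (simp only: z(2) times_divide_eq_right nonzero_mult_div_cancel_left[OF two])
  have p: "oct_norm p = 0" "oct_inner p a = \<alpha> / 2" "p \<star> oct_conj w = b"
    by (simp_all add: p_def oct_norm_mult b oct_inner_mult(1) w oct_right_cancel oct_linear)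
  have pv: "p \<star> v = oct_scale 2 b"
    by (simp add: v_def oct_linear p oct_left_cancel)
  have "oct_norm v = 4 + 2 * oct_inner z b"
    using oct_inner_mult(1)[of "oct_conj p" z "oct_conj w"]
    by (simp add: v_def oct_linear oct_norm_add oct_norm_scale oct_norm_conj oct_norm_mult w p
        oct_inner_commute[of "oct_conj w"] z(1))
  then have gv: "oct_norm g + oct_norm v = 0"
    by (simp add: z2)
  have "short_word (Suc (Suc 0)) (Herm 0 1 0 g 0 v)"
    using within_words_mult[OF within_words_idempotent[OF herm_idempotent_rank1[OF two, of "oct_scale 2 g" "oct_scale 2 v"]]
        herm_idempotent_diag[OF two, of 0 1 0], of 0] gv two
    by (simp add: oct_norm_scale herm_mult_def oct_linear flip: distrib_left)
  moreover have "2 * oct_inner p a = \<alpha>"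
    by (simp only: p(2) times_divide_eq_right nonzero_mult_div_cancel_left[OF two])
  then have "oct_inner p g = \<alpha>"
    by (simp add: g_def oct_linear oct_inner_self p(1))
  moreover have "g + oct_scale (1 - \<alpha>) p = oct_scale 2 a"
    by (simp add: g_def)
  ultimately have "short_word (Suc (Suc 0)) (Herm \<alpha> (1 - \<alpha>) 0 (oct_scale 2 a) (oct_scale 2 b) v)"
    using short_word_shear12[OF p(1), of _ "Herm 0 1 0 g 0 v"] pv by (simp add: oct_linear)
  then show ?thesis
    using short_word_free_block[OF two] by (simp add: numeral_3_eq_3)
qed

text \<open>
  A shear in the indices 2 and 3, obtained from \<open>shear12\<close> by moving the row to the third index.
\<close>

lemma short_word_row_shear:
  assumes "oct_norm u = 0"
  shows "short_word k (Herm \<alpha> 0 0 (a + b \<star> oct_conj u) (b - a \<star> u) 0) \<longleftrightarrow> short_word k (Herm \<alpha> 0 0 a b 0)"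
proof -
  have "shear12 u (swap23 (swap12 (Herm \<alpha> 0 0 a b 0))) = swap23 (swap12 (Herm \<alpha> 0 0 (a + b \<star> oct_conj u) (b - a \<star> u) 0))"
    by (simp add: oct_linear oct_conj_mult)
  then show ?thesis
    by (metis assms short_word_shear12 short_word_swap12 short_word_swap23)
qed


text \<open>
  A shear by a nonzero null \<open>u\<close> replaces the vanishing entry by \<open>- a u\<close>, which is null and nonzero.
\<close>

lemma short_word_row_single:
  fixes a :: "'a::field oct"
  assumes two: "(2::'a) \<noteq> 0" and a: "oct_norm a \<noteq> 0"
  shows "short_word 3 (Herm \<alpha> 0 0 a 0 0)"
proof -
  obtain u :: "'a oct" where u: "oct_norm u = 0" "u \<noteq> 0" using oct_exists_null by blast
  have "a \<star> u \<noteq> 0" using oct_mult_eq_0_left[OF _ a] u(2) by blast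
  moreover have "oct_conj (- (a \<star> u)) \<star> a = oct_scale (- oct_norm a) (oct_conj u)"
    by (simp add: oct_linear oct_conj_mult oct_right_cancel)
  ultimately have "short_word 3 (Herm \<alpha> 0 0 a (- (a \<star> u)) 0)"
    by (intro short_word_row_null[OF two])
      (simp_all add: oct_norm_mult u oct_norm_minus oct_scale_eq_0_iff oct_conj_eq_0_iff a)
  then show ?thesis
    using short_word_row_shear[OF u(1), of 3 \<alpha> a 0] by (simp add: oct_linear)
qed

text \<open>
  A shear of the pair \<open>(a, b)\<close> preserves \<open>n(a) + n(b)\<close>. It is chosen so that the second entry becomes
  null, say \<open>(a', b')\<close> with \<open>n(a') = n(a) + n(b)\<close>. If this is nonzero, \<open>conj b' a' \<noteq> 0\<close> by
  cancellation unless \<open>b' = 0\<close>, which is the case of a single entry. If it is zero, then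
  \<open>conj b' a' = conj b a + n(b) conj u\<close> is nonzero, because \<open>conj b a\<close> is not null but \<open>conj u\<close> is.
\<close>

lemma short_word_row_anisotropic:
  fixes a b :: "'a::field oct"
  assumes two: "(2::'a) \<noteq> 0" and a: "oct_norm a \<noteq> 0"
  shows "short_word 3 (Herm \<alpha> 0 0 a b 0)"
proof (cases "oct_conj a \<star> b = 0")
  case True
  then have "b = 0" using a oct_mult_eq_0_left[of "oct_conj a" b] by (simp add: oct_norm_conj)
  then show ?thesis using short_word_row_single[OF assms] by simp
next
  case False
  then obtain u where u: "oct_norm u = 0" "oct_inner u (oct_conj a \<star> b) = oct_norm b"
    using oct_exists_null_inner by blast
  define a' where "a' = a + b \<star> oct_conj u"
  define b' where "b' = b - a \<star> u"
  have inner: "oct_inner b (a \<star> u) = oct_norm b" "oct_inner a (b \<star> oct_conj u) = oct_norm b"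
    using u(2) oct_inner_mult[of a u b] by (simp_all add: oct_inner_commute)
  have b': "oct_norm b' = 0" and a': "oct_norm a' = oct_norm a + oct_norm b"
    by (simp_all add: a'_def b'_def oct_norm_diff oct_norm_add oct_norm_mult oct_norm_conj u inner)
  have "short_word 3 (Herm \<alpha> 0 0 a' b' 0)"
  proof (cases "oct_norm a' = 0")
    case False
    then show ?thesis
      using short_word_row_single[OF two False, of \<alpha>] short_word_row_null[OF two b', of a' \<alpha>]
        oct_mult_eq_0_right[of "oct_conj b'" a'] oct_conj_eq_0_iff[of b'] by metis
  next
    case True
    then have na: "oct_norm a = - oct_norm b" using a' by (simp add: eq_neg_iff_add_eq_0)
    have "(oct_conj u \<star> oct_conj a) \<star> (b \<star> oct_conj u) = oct_scale (oct_norm b) (oct_conj u)"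
      using oct_moufang[of "oct_conj u" "oct_conj a" b] u
      by (simp add: oct_inner_conj oct_norm_conj oct_linear)
    moreover have "(oct_conj u \<star> oct_conj a) \<star> a = oct_scale (oct_norm a) (oct_conj u)"
      "oct_conj b \<star> (b \<star> oct_conj u) = oct_scale (oct_norm b) (oct_conj u)"
      by (rule oct_right_cancel oct_left_cancel)+
    ultimately have eq: "oct_conj b' \<star> a' = oct_conj b \<star> a + oct_scale (oct_norm b) (oct_conj u)"
      by (simp add: a'_def b'_def oct_linear oct_conj_mult na)
    have ne: "oct_conj b' \<star> a' \<noteq> 0"
    proof
      assume "oct_conj b' \<star> a' = 0"
      then have "oct_conj b \<star> a = - oct_scale (oct_norm b) (oct_conj u)"
        using eq by (simp add: eq_neg_iff_add_eq_0)
      then have "oct_norm (oct_conj b \<star> a) = 0"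
        by (simp add: oct_norm_minus oct_norm_scale oct_norm_conj u)
      then show False using a na by (simp add: oct_norm_mult oct_norm_conj)
    qed
    then have "b' \<noteq> 0" by (auto simp: oct_linear)
    then show ?thesis using short_word_row_null[OF two b' _ ne] by simp
  qed
  then show ?thesis
    using short_word_row_shear[OF u(1), of 3 \<alpha> a b] by (simp add: a'_def b'_def)
qed

lemma short_word_row:
  fixes a b :: "'a::field oct"
  assumes two: "(2::'a) \<noteq> 0" and "oct_norm a \<noteq> 0 \<or> oct_norm b \<noteq> 0"
  shows "short_word 3 (Herm \<alpha> 0 0 a b 0)"
  using assms(2) short_word_row_anisotropic[OF two, of a \<alpha> b] short_word_row_anisotropic[OF two, of b \<alpha> a]
    short_word_swap23[of 3 "Herm \<alpha> 0 0 a b 0"] by (auto simp: oct_linear)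

lemma short_word_cycle:
  "short_word k (Herm \<beta> \<gamma> \<alpha> c (oct_conj a) (oct_conj b)) \<longleftrightarrow> short_word k (Herm \<alpha> \<beta> \<gamma> a b c)"
  using short_word_swap12[of k "Herm \<alpha> \<beta> \<gamma> a b c"]
    short_word_swap23[of k "swap12 (Herm \<alpha> \<beta> \<gamma> a b c)"] by simp

section \<open>Elements with zero diagonal\<close>

text \<open>
  The pair \<open>(b, c)\<close> behaves as a spinor with quadratic form \<open>n(b) + n(c)\<close>: a first shear makes \<open>c\<close>
  null, a second one then removes it, and \<open>b\<close> ends up with norm \<open>n(b) + n(c)\<close>. Neither shear
  parameter depends on \<open>s\<close>, and the part \<open>diag(s, s)\<close> of the upper left block commutes with both. So
  the final entry 22 is \<open>s\<close> plus a constant, and \<open>s\<close> is chosen to make it vanish.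
\<close>

lemma short_word_to_row:
  fixes a b c :: "'a::field oct"
  assumes k: "oct_norm b + oct_norm c \<noteq> 0"
  obtains s \<alpha> and a' b' :: "'a oct" where "oct_norm b' \<noteq> 0"
    "\<And>k. short_word k (Herm \<alpha> 0 0 a' b' 0) \<longleftrightarrow> short_word k (Herm s s 0 a b c)"
proof (cases "b \<star> oct_conj c = 0")
  case True
  consider "c = 0" "oct_norm b \<noteq> 0" | "b = 0" "oct_norm c \<noteq> 0"
    using k True oct_mult_eq_0_left[of b "oct_conj c"] oct_mult_eq_0_right[of b "oct_conj c"]
    by (cases "oct_norm b = 0") (auto simp: oct_norm_conj oct_conj_eq_0_iff oct_norm_zero)
  then show ?thesis
  proof cases
    case 1
    then show ?thesis by (intro that[of b 0 a 0]) simp_all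
  next
    case 2
    then show ?thesis
      using short_word_swap12[of _ "Herm 0 0 0 a b c"] by (intro that[of c 0 "oct_conj a" 0]) simp_all
  qed
next
  case False
  then obtain u where u: "oct_norm u = 0" "oct_inner u (b \<star> oct_conj c) = oct_norm c"
    using oct_exists_null_inner by blast
  define \<kappa> where "\<kappa> = oct_norm b + oct_norm c"
  define a' where "a' = a - oct_scale (oct_inner u a) u"
  define b' where "b' = b + u \<star> c"
  define c' where "c' = c - oct_conj u \<star> b"
  define u' where "u' = oct_scale (1 / \<kappa>) (b' \<star> oct_conj c')"
  define s where "s = oct_inner u a + oct_inner u' a'"
  have \<kappa>: "\<kappa> \<noteq> 0" using k by (simp add: \<kappa>_def)
  have inner: "oct_inner b (u \<star> c) = oct_norm c" "oct_inner c (oct_conj u \<star> b) = oct_norm c"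
    using u(2) oct_inner_mult(2)[of u c b] oct_inner_mult(1)[of u c b]
    by (simp_all add: oct_inner_commute)
  have b': "oct_norm b' = \<kappa>" and c': "oct_norm c' = 0"
    by (simp_all add: b'_def c'_def \<kappa>_def oct_norm_add oct_norm_diff oct_norm_mult oct_norm_conj u inner)
  have u': "oct_norm u' = 0" "u' \<star> c' = 0" "oct_conj u' \<star> b' = c'"
    using \<kappa> by (simp_all add: u'_def oct_norm_scale oct_norm_mult oct_norm_conj c' b' oct_linear
        oct_right_cancel oct_conj_mult)
  have "shear12 u (Herm s s 0 a b c) = Herm (s + oct_inner u a) (oct_inner u' a') 0 a' b' c'"
    by (simp add: a'_def b'_def c'_def s_def oct_linear)
  moreover obtain \<alpha> a'' where "shear12 u' (Herm (s + oct_inner u a) (oct_inner u' a') 0 a' b' c') = Herm \<alpha> 0 0 a'' b' 0"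
    by (simp add: u')
  ultimately show ?thesis
    using that[of b' \<alpha> a'' s] short_word_shear12[OF u(1)] short_word_shear12[OF u'(1)] b' \<kappa> by metis
qed

lemma short_word_zero_diag_generic:
  fixes a b c :: "'a::field oct"
  assumes two: "(2::'a) \<noteq> 0" and k: "oct_norm b + oct_norm c \<noteq> 0"
  shows "short_word 5 (Herm 0 0 0 a b c)"
proof -
  have "oct_norm (oct_scale 2 b) + oct_norm (oct_scale 2 c) \<noteq> 0"
    using two k by (simp only: oct_norm_scale mult_eq_0_iff power_eq_0_iff simp_thms flip: distrib_left)
  then obtain s where "short_word 3 (Herm s s 0 (oct_scale 2 (oct_scale 2 a)) (oct_scale 2 b) (oct_scale 2 c))"
    using short_word_to_row[of "oct_scale 2 b" "oct_scale 2 c" "oct_scale 2 (oct_scale 2 a)"] short_word_row[OF two] by metis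
  then have "short_word (Suc (Suc 3)) (Herm 0 0 0 a b c)"
    by (intro short_word_free2[OF two] short_word_free1[OF two])
  then show ?thesis by (simp add: eval_nat_numeral)
qed

text \<open>
  If all three sums of two of the norms vanish then so do the norms, since 2 is invertible; hence
  one of the sums is nonzero, and a permutation of the indices brings it into the required position.
\<close>

lemma short_word_zero_diag_anisotropic:
  fixes a b c :: "'a::field oct"
  assumes two: "(2::'a) \<noteq> 0" and n: "oct_norm a \<noteq> 0 \<or> oct_norm b \<noteq> 0 \<or> oct_norm c \<noteq> 0"
  shows "short_word 5 (Herm 0 0 0 a b c)"
proof -
  consider "oct_norm b + oct_norm c \<noteq> 0" | "oct_norm a + oct_norm c \<noteq> 0" | "oct_norm a + oct_norm b \<noteq> 0"
  proof (rule ccontr)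
    assume "\<not> thesis"
    then have *: "oct_norm b = - oct_norm c" "oct_norm a = - oct_norm c" "oct_norm a + oct_norm b = 0"
      using that by (auto simp: eq_neg_iff_add_eq_0)
    have "2 * oct_norm c = - (oct_norm a + oct_norm b)" by (simp only: *(1,2)) simp
    then have "oct_norm c = 0" using two by (simp only: *(3)) simp
    then show False using n *(1,2) by simp
  qed
  then show ?thesis
  proof cases
    case 1 then show ?thesis by (rule short_word_zero_diag_generic[OF two])
  next
    case 2 then show ?thesis
      using short_word_zero_diag_generic[OF two, of a "oct_conj c" b] short_word_swap23[of 5 "Herm 0 0 0 a b c"]
      by (simp add: oct_norm_conj)
  next
    case 3 then show ?thesis
      using short_word_zero_diag_generic[OF two, of "oct_conj a" "oct_conj b" c] short_word_cycle[of 5 0 0 0 c a b]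
      by (simp add: oct_norm_conj)
  qed
qed

text \<open>
  A shear by a multiple of the null entry \<open>a\<close> leaves the diagonal unchanged and rescales \<open>a\<close>; if the
  two diagonal entries differ, the multiple can be chosen so as to remove \<open>a\<close>.
\<close>

lemma short_word_null_entry:
  fixes a b c :: "'a::field oct"
  assumes "oct_norm a = 0" "\<kappa> * (\<alpha> - \<beta>) = 1"
  shows "short_word k (Herm \<alpha> \<beta> \<gamma> 0 (b + oct_scale \<kappa> (a \<star> c)) (c - oct_scale \<kappa> (oct_conj a \<star> b)))
    \<longleftrightarrow> short_word k (Herm \<alpha> \<beta> \<gamma> a b c)"
proof -
  have "(\<beta> - \<alpha>) * \<kappa> = - 1" using assms(2) by (simp add: algebra_simps) 
  then have "shear12 (oct_scale \<kappa> a) (Herm \<alpha> \<beta> \<gamma> a b c)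
    = Herm \<alpha> \<beta> \<gamma> 0 (b + oct_scale \<kappa> (a \<star> c)) (c - oct_scale \<kappa> (oct_conj a \<star> b))"
    by (simp add: oct_inner_self assms(1) oct_linear flip: oct_scale_diff)
  then show ?thesis
    using short_word_shear12[of "oct_scale \<kappa> a"] assms(1) by (metis mult_zero_right oct_norm_scale)
qed

text \<open>
  The block with diagonal \<open>(1, -1)\<close> and null off-diagonal entry has trace zero and determinant
  \<open>-1\<close>, so a shear turns it into a block with zero diagonal whose off-diagonal entry has norm 1.
\<close>

lemma short_word_hyperbolic_pair:
  fixes d :: "'a::field oct"
  assumes two: "(2::'a) \<noteq> 0" and d: "oct_norm d = 0"
  shows "short_word 3 (Herm 1 (- 1) 0 d 0 0)"
proof -
  have *: "short_word 3 (Herm 1 (- 1) 0 d 0 0)" if d: "oct_norm d = 0" "d \<noteq> 0" for d :: "'a oct"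
  proof -
    obtain u where u: "oct_norm u = 0" "oct_inner u d = - 1"
      using oct_exists_null_inner[OF d(2)] by blast
    have "shear12 u (Herm 1 (- 1) 0 d 0 0) = Herm 0 0 0 (d - u) 0 0"
      by (simp add: u oct_linear)
    moreover have "oct_norm (d - u) = 1"
      by (simp add: oct_norm_diff d u oct_inner_commute[of d])
    ultimately show ?thesis
      using short_word_row[OF two, of "d - u" 0 0] short_word_shear12[OF u(1)] by (metis zero_neq_one)
  qed
  show ?thesis
  proof (cases "d = 0")
    case True
    obtain u :: "'a oct" where u: "oct_norm u = 0" "u \<noteq> 0" using oct_exists_null by blast
    have "shear12 u (Herm 1 (- 1) 0 d 0 0) = Herm 1 (- 1) 0 (oct_scale (- 1 - 1) u) 0 0"
      by (simp add: True oct_linear)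
    moreover have "oct_scale (- 1 - 1) u \<noteq> 0"
      using two u(2) by (simp add: oct_scale_eq_0_iff)
    ultimately show ?thesis
      using * short_word_shear12[OF u(1)] u(1) by (metis mult_zero_right oct_norm_scale)
  qed (use * d in blast)
qed

text \<open>
  Removing one null entry changes the two others, but they remain null because \<open>\<langle>a, b conj c\<rangle> = 0\<close>.
  The order of removal matters: after the first two steps the entries that remain are, up to
  conjugation and sign, \<open>c1\<close> and \<open>b1 conj c1\<close>. These have product zero, so that the third removal
  does not recreate any entry.
\<close>

lemma short_word_null_offdiag:
  fixes a b c :: "'a::field oct"
  assumes two: "(2::'a) \<noteq> 0" and n: "oct_norm a = 0" "oct_norm b = 0" "oct_norm c = 0"
    and abc: "oct_inner a (b \<star> oct_conj c) = 0"
  shows "short_word 3 (Herm (- 1) 1 0 a b c)"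
proof -
  define \<kappa> :: 'a where "\<kappa> = - 1 / 2"
  have \<kappa>: "\<kappa> * (- 1 - 1) = 1" using two by (simp add: \<kappa>_def)
  define b1 where "b1 = b + oct_scale \<kappa> (a \<star> c)"
  define c1 where "c1 = c - oct_scale \<kappa> (oct_conj a \<star> b)"
  have inner: "oct_inner b (a \<star> c) = 0" "oct_inner c (oct_conj a \<star> b) = 0"
    using abc oct_inner_mult(1)[of a c b] oct_inner_mult(2)[of a c b] by (simp_all add: oct_inner_commute)
  have n1: "oct_norm b1 = 0" "oct_norm c1 = 0"
    by (simp_all add: b1_def c1_def oct_norm_add oct_norm_diff oct_norm_scale oct_norm_mult
        oct_norm_conj oct_linear n inner)
  define b2 where "b2 = oct_scale (- 1) (b1 \<star> oct_conj c1)"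
  have "short_word 3 (Herm (- 1) 1 0 a b c) \<longleftrightarrow> short_word 3 (Herm (- 1) 1 0 0 b1 c1)"
    using short_word_null_entry[OF n(1) \<kappa>] by (simp add: b1_def c1_def)
  also have "\<dots> \<longleftrightarrow> short_word 3 (Herm (- 1) 0 1 b1 0 (oct_conj c1))"
    using short_word_swap23[of 3 "Herm (- 1) 1 0 0 b1 c1"] by simp
  also have "\<dots> \<longleftrightarrow> short_word 3 (Herm (- 1) 0 1 0 b2 (oct_conj c1))"
    using short_word_null_entry[OF n1(1), of "- 1" "- 1" 0 3 1 0 "oct_conj c1"] by (simp add: b2_def oct_linear)
  also have "\<dots> \<longleftrightarrow> short_word 3 (Herm 0 1 (- 1) (oct_conj c1) 0 (oct_conj b2))"
    using short_word_cycle[of 3 0 1 "- 1" "oct_conj c1" 0 b2] by (simp add: oct_linear)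
  also have "\<dots> \<longleftrightarrow> short_word 3 (Herm 0 1 (- 1) 0 0 (oct_conj b2))"
    using short_word_null_entry[of "oct_conj c1" "- 1" 0 1 3 "- 1" 0 "oct_conj b2"] n1
    by (simp add: b2_def oct_linear oct_norm_conj oct_conj_mult oct_left_cancel)
  also have "\<dots> \<longleftrightarrow> short_word 3 (Herm 1 (- 1) 0 (oct_conj b2) 0 0)"
    using short_word_cycle[of 3 1 "- 1" 0 "oct_conj b2" 0 0] by (simp add: oct_linear)
  also have \<dots>
    by (intro short_word_hyperbolic_pair[OF two])
      (simp add: b2_def oct_norm_scale oct_norm_mult oct_norm_conj n1)
  finally show ?thesis .
qed

text \<open>
  If all three entries are null and \<open>\<langle>a, b conj c\<rangle>\<close> is nonzero, shearing by \<open>a\<close> itself keeps the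
  diagonal zero and produces an entry of norm \<open>\<langle>a, b conj c\<rangle>\<close>.
\<close>

lemma short_word_zero_diag:
  fixes a b c :: "'a::field oct"
  assumes two: "(2::'a) \<noteq> 0"
  shows "short_word 6 (Herm 0 0 0 a b c)"
proof (cases "oct_norm a \<noteq> 0 \<or> oct_norm b \<noteq> 0 \<or> oct_norm c \<noteq> 0")
  case True
  then show ?thesis
    using short_word_zero_diag_anisotropic[OF two True] within_words_mono[of _ _ 5 _ 6] by simp
next
  case False
  then have n: "oct_norm a = 0" "oct_norm b = 0" "oct_norm c = 0" by auto
  show ?thesis
  proof (cases "oct_inner a (b \<star> oct_conj c) = 0")
    case True
    let ?f = "\<lambda>x. oct_scale 2 (oct_scale 2 x)"
    have "short_word 3 (Herm (- 1) 1 0 (?f a) (?f b) (?f c))"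
      by (rule short_word_null_offdiag[OF two]) (simp_all add: oct_norm_scale n oct_linear True)
    then have "short_word (Suc (Suc (Suc 3))) (Herm 0 0 0 a b c)"
      by (intro short_word_free3[OF two] short_word_free2[OF two] short_word_free1[OF two])
    then show ?thesis by (simp add: eval_nat_numeral)
  next
    case False
    have "shear12 a (Herm 0 0 0 a b c) = Herm 0 0 0 a (b + a \<star> c) (c - oct_conj a \<star> b)"
      by (simp add: oct_inner_self n oct_linear)
    moreover have "oct_norm (b + a \<star> c) \<noteq> 0"
      using False oct_inner_mult(2)[of a c b]
      by (simp add: oct_norm_add oct_norm_mult n oct_inner_commute[of b])
    ultimately have "short_word 5 (Herm 0 0 0 a b c)"
      using short_word_zero_diag_anisotropic[OF two] short_word_shear12[OF n(1)] by metis
    then show ?thesis using within_words_mono[of _ _ 5 _ 6] by simp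
  qed
qed

section \<open>Nonscalar elements\<close>

text \<open>
  With a nonzero entry \<open>a\<close> a shear moves \<open>\<beta>\<close> from the first to the second diagonal position, where
  it cancels. If \<open>a = 0\<close> and \<open>\<beta> \<noteq> 0\<close>, then \<open>\<beta> \<noteq> - \<beta>\<close> and any shear creates a nonzero entry there
  without changing the diagonal.
\<close>

lemma short_word_traceless_corner:
  fixes a b c :: "'a::field oct"
  assumes two: "(2::'a) \<noteq> 0"
  shows "short_word 6 (Herm \<beta> (- \<beta>) 0 a b c)"
proof -
  have *: "short_word 6 (Herm \<beta> (- \<beta>) 0 a b c)" if a: "a \<noteq> 0" for a b c :: "'a oct"
  proof -
    obtain u where u: "oct_norm u = 0" "oct_inner u a = - \<beta>"
      using oct_exists_null_inner[OF a] by blast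
    then show ?thesis
      using short_word_shear12[OF u(1), of 6 "Herm \<beta> (- \<beta>) 0 a b c"] short_word_zero_diag[OF two] by simp
  qed
  show ?thesis
  proof (cases "a = 0 \<and> \<beta> \<noteq> 0")
    case True
    obtain u :: "'a oct" where u: "oct_norm u = 0" "u \<noteq> 0" using oct_exists_null by blast
    have "oct_scale (- \<beta> - \<beta>) u \<noteq> 0"
      using two u(2) True by (simp add: oct_scale_eq_0_iff flip: mult_2)
    then show ?thesis
      using True * short_word_shear12[OF u(1), of 6 "Herm \<beta> (- \<beta>) 0 a b c"] by (simp add: oct_linear)
  next
    case False
    then show ?thesis using *[of a b c] short_word_zero_diag[OF two, of a b c] by auto
  qed
qed

text \<open>
  Permuting the indices moves any nonzero off-diagonal entry to position 12. The condition \<open>P\<close>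
  depends on the trace alone, so that it is stable under these permutations.
\<close>

lemma short_word_offdiag_cases:
  assumes "\<And>\<alpha> \<beta> \<gamma> a b c. P (\<alpha> + \<beta> + \<gamma>) \<Longrightarrow> a \<noteq> 0 \<Longrightarrow> short_word k (Herm \<alpha> \<beta> \<gamma> a b c)"
    and "P (\<alpha> + \<beta> + \<gamma>)" "a \<noteq> 0 \<or> b \<noteq> 0 \<or> c \<noteq> 0"
  shows "short_word k (Herm \<alpha> \<beta> \<gamma> a b c)"
  using assms(3)
proof (elim disjE)
  assume "a \<noteq> 0"
  then show ?thesis using assms by blast
next
  assume "b \<noteq> 0"
  then show ?thesis
    using assms(1)[of \<alpha> \<gamma> \<beta> b a "oct_conj c"] assms(2) short_word_swap23[of k "Herm \<alpha> \<beta> \<gamma> a b c"]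
    by (simp add: ac_simps)
next
  assume "c \<noteq> 0"
  then show ?thesis
    using assms(1)[of \<beta> \<gamma> \<alpha> c "oct_conj a" "oct_conj b"] assms(2) short_word_cycle[of k \<beta> \<gamma> \<alpha> c a b]
    by (simp add: ac_simps)
qed

text \<open>
  A nonzero off-diagonal entry adjacent to \<open>\<alpha>\<close> allows a shear that moves all of \<open>\<alpha>\<close> to another
  diagonal position. The trace \<open>t\<close> is preserved by the shear and by permutations.
\<close>

lemma short_word_clear_corner:
  assumes "\<And>\<beta> \<gamma> a b c. \<beta> + \<gamma> = t \<Longrightarrow> short_word k (Herm \<beta> \<gamma> 0 a b c)"
    and "\<alpha> + \<beta> + \<gamma> = t" "a \<noteq> 0 \<or> b \<noteq> 0 \<or> c \<noteq> 0"
  shows "short_word k (Herm \<alpha> \<beta> \<gamma> a b c)"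
proof (rule short_word_offdiag_cases[where P = "\<lambda>x. x = t", OF _ assms(2,3)])
  fix \<alpha> \<beta> \<gamma> and a b c :: "'a oct"
  assume t: "\<alpha> + \<beta> + \<gamma> = t" and "a \<noteq> 0"
  then obtain u where u: "oct_norm u = 0" "oct_inner u a = - \<alpha>"
    using oct_exists_null_inner by blast
  obtain a' b' c' where "shear12 u (Herm \<alpha> \<beta> \<gamma> a b c) = Herm 0 (\<alpha> + \<beta>) \<gamma> a' b' c'"
    using u(2) by (simp add: add.commute)
  then show "short_word k (Herm \<alpha> \<beta> \<gamma> a b c)"
    using short_word_shear12[OF u(1)] short_word_cycle[of k "\<alpha> + \<beta>" \<gamma> 0 c' a' b']
      assms(1)[of "\<alpha> + \<beta>" \<gamma>] t by metis
qed

text \<open>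
  If some off-diagonal entry is nonzero, the free corner is used to make the trace zero; a nonzero
  off-diagonal entry survives, and this is what excludes a scalar matrix, which can have trace zero in
  characteristic 3. A diagonal element is first sheared to create an off-diagonal entry.
\<close>

lemma short_word_zero_corner:
  fixes a b c :: "'a::field oct"
  assumes two: "(2::'a) \<noteq> 0"
  shows "short_word 7 (Herm \<beta> \<gamma> 0 a b c)"
proof -
  have *: "short_word 7 (Herm \<beta> \<gamma> 0 a b c)" if "a \<noteq> 0 \<or> b \<noteq> 0 \<or> c \<noteq> 0" for \<beta> \<gamma> and a b c :: "'a oct"
  proof -
    have "short_word 6 (Herm \<beta> \<gamma> (- \<beta> - \<gamma>) a (oct_scale 2 b) (oct_scale 2 c))"
    proof (rule short_word_clear_corner[where t = 0])
      show "short_word 6 (Herm \<beta> \<gamma> 0 a b c)" if "\<beta> + \<gamma> = 0" for \<beta> \<gamma> and a b c :: "'a oct"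
        using that short_word_traceless_corner[OF two, of \<beta>] by (simp add: add_eq_0_iff)
    qed (use that two in \<open>simp_all add: oct_scale_eq_0_iff\<close>)
    then have "short_word (Suc 6) (Herm \<beta> \<gamma> 0 a b c)"
      by (rule short_word_free3[OF two])
    then show ?thesis by (simp add: eval_nat_numeral)
  qed
  have diag: "short_word 7 (Herm \<beta> \<gamma> 0 0 0 0)" if "\<beta> \<noteq> 0" for \<beta> \<gamma> :: 'a
  proof -
    obtain u :: "'a oct" where u: "oct_norm u = 0" "u \<noteq> 0" using oct_exists_null by blast
    have "short_word 7 (Herm \<beta> 0 \<gamma> (oct_scale (- \<beta>) u) 0 0)"
      using *[of 0 "oct_scale (- \<beta>) u" 0 \<beta> \<gamma>] that u(2)
        short_word_swap23[of 7 "Herm \<beta> \<gamma> 0 0 (oct_scale (- \<beta>) u) 0"]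
      by (simp add: oct_scale_eq_0_iff oct_conj_zero)
    then show ?thesis
      using short_word_shear12[OF u(1), of 7 "Herm \<beta> 0 \<gamma> 0 0 0"] short_word_swap23[of 7 "Herm \<beta> \<gamma> 0 0 0 0"]
      by (simp add: oct_linear)
  qed
  consider "a \<noteq> 0 \<or> b \<noteq> 0 \<or> c \<noteq> 0" | "a = 0" "b = 0" "c = 0" "\<beta> \<noteq> 0"
    | "a = 0" "b = 0" "c = 0" "\<gamma> \<noteq> 0" | "a = 0" "b = 0" "c = 0" "\<beta> = 0" "\<gamma> = 0"
    by blast
  then show ?thesis
  proof cases
    case 3
    then show ?thesis
      using diag[of \<gamma> \<beta>] short_word_swap12[of 7 "Herm \<beta> \<gamma> 0 0 0 0"] by (simp add: oct_conj_zero)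
  next
    case 4
    then show ?thesis
      using within_words_idempotent[OF herm_idempotent_diag[OF two, of 0 0 0], of 6] by (simp add: eval_nat_numeral)
  qed (use * diag in auto)
qed

lemma short_word_nonscalar:
  fixes a b c :: "'a::field oct"
  assumes two: "(2::'a) \<noteq> 0" and x: "Herm \<alpha> \<beta> \<gamma> a b c \<noteq> Herm \<alpha> \<alpha> \<alpha> 0 0 0"
  shows "short_word 7 (Herm \<alpha> \<beta> \<gamma> a b c)"
proof -
  have *: "short_word 7 (Herm \<alpha> \<beta> \<gamma> a b c)" if "a \<noteq> 0 \<or> b \<noteq> 0 \<or> c \<noteq> 0" for \<alpha> \<beta> \<gamma> and a b c :: "'a oct"
    using short_word_clear_corner[OF _ refl that] short_word_zero_corner[OF two] by blast
  have diag: "short_word 7 (Herm \<alpha> \<beta> \<gamma> 0 0 0)" if "\<alpha> \<noteq> \<beta>" for \<alpha> \<beta> \<gamma> :: 'a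
  proof -
    obtain u :: "'a oct" where u: "oct_norm u = 0" "u \<noteq> 0" using oct_exists_null by blast
    have "oct_scale (\<beta> - \<alpha>) u \<noteq> 0" using that u(2) by (simp add: oct_scale_eq_0_iff)
    then show ?thesis
      using * short_word_shear12[OF u(1), of 7 "Herm \<alpha> \<beta> \<gamma> 0 0 0"] by (simp add: oct_linear)
  qed
  show ?thesis
  proof (cases "a \<noteq> 0 \<or> b \<noteq> 0 \<or> c \<noteq> 0")
    case False
    then show ?thesis
      using x diag[of \<alpha> \<beta> \<gamma>] diag[of \<alpha> \<gamma> \<beta>] short_word_swap23[of 7 "Herm \<alpha> \<beta> \<gamma> 0 0 0"]
      by (auto simp: oct_conj_zero)
  qed (rule *)
qed

section \<open>Scalars that are words\<close>

fun herm_trace :: "'a::field herm \<Rightarrow> 'a" where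
  "herm_trace (Herm \<alpha> \<beta> \<gamma> a b c) = \<alpha> + \<beta> + \<gamma>"

lemma herm_trace_scale: "herm_trace (herm_scale r x) = r * herm_trace x"
  by (cases x) (simp add: algebra_simps)

lemma herm_anticomm_scale:
  "herm_anticomm (herm_scale r x) y = herm_scale r (herm_anticomm x y)"
  "herm_anticomm x (herm_scale r y) = herm_scale r (herm_anticomm x y)"
  by (cases x; cases y; simp add: oct_linear algebra_simps)+

lemma herm_trace_anticomm_assoc:
  "herm_trace (herm_anticomm (herm_anticomm x y) z) = herm_trace (herm_anticomm x (herm_anticomm y z))"
proof -
  obtain \<alpha> \<beta> \<gamma> a b c where x: "x = Herm \<alpha> \<beta> \<gamma> a b c" by (cases x)
  obtain \<alpha>' \<beta>' \<gamma>' a' b' c' where y: "y = Herm \<alpha>' \<beta>' \<gamma>' a' b' c'" by (cases y)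
  obtain \<alpha>'' \<beta>'' \<gamma>'' a'' b'' c'' where z: "z = Herm \<alpha>'' \<beta>'' \<gamma>'' a'' b'' c''" by (cases z)
  have rot: "oct_inner (p \<star> oct_conj q) r = oct_inner p (r \<star> q)"
    "oct_inner r (p \<star> oct_conj q) = oct_inner p (r \<star> q)"
    "oct_inner (oct_conj r \<star> p) q = oct_inner p (r \<star> q)"
    "oct_inner q (oct_conj r \<star> p) = oct_inner p (r \<star> q)" for p q r :: "'a oct"
    by (simp_all add: oct_coords algebra_simps)
  have comm: "oct_inner (p \<star> q) b'' = oct_inner b'' (p \<star> q)" for p q
    by (rule oct_inner_commute)
  show ?thesis
    by (simp add: x y z oct_linear rot comm algebra_simps)
qed

lemma herm_trace_assoc:
  "herm_trace (herm_mult (herm_mult x y) z) = herm_trace (herm_mult x (herm_mult y z))"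
  by (simp add: herm_mult_def herm_anticomm_scale herm_trace_scale herm_trace_anticomm_assoc)

definition herm_scalar :: "'a::field \<Rightarrow> 'a herm" where
  "herm_scalar \<alpha> = Herm \<alpha> \<alpha> \<alpha> 0 0 0"

lemma herm_mult_scalar:
  fixes x :: "'a::field herm"
  assumes "(2::'a) \<noteq> 0"
  shows "herm_mult (herm_scalar \<alpha>) x = herm_scale \<alpha> x" "herm_mult x (herm_scalar \<alpha>) = herm_scale \<alpha> x"
proof -
  have "y + y = oct_scale 2 y" for y :: "'a oct"
    by (simp add: oct_coords)
  then have "herm_anticomm (herm_scalar \<alpha>) x = herm_scale 2 (herm_scale \<alpha> x)"
    "herm_anticomm x (herm_scalar \<alpha>) = herm_scale 2 (herm_scale \<alpha> x)"
    by (cases x; simp add: herm_scalar_def oct_linear mult_ac)+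
  moreover have "herm_scale (1/2) (herm_scale 2 y) = y" for y :: "'a herm"
    using assms by (cases y) (simp add: oct_linear)
  ultimately show "herm_mult (herm_scalar \<alpha>) x = herm_scale \<alpha> x" "herm_mult x (herm_scalar \<alpha>) = herm_scale \<alpha> x"
    by (simp_all add: herm_mult_def)
qed

text \<open>
  Comparing off-diagonal entries of \<open>e \<circ> e = e\<close> gives \<open>b conj c = p a\<close> and its two analogues, and
  multiplying these by octonions expresses the norms through \<open>p\<close>, \<open>q\<close>, \<open>r\<close>. If at least two
  off-diagonal entries are nonzero, all three norms are determined, and the first diagonal entry of
  \<open>e \<circ> e = e\<close> becomes \<open>(tr(e) - 1) (tr(e) - 2) = 0\<close>. Otherwise \<open>e\<close> splits into blocks of sizes 2 and 1
  or is diagonal.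
\<close>

lemma herm_idempotent_trace:
  fixes e :: "'a::field herm"
  assumes two: "(2::'a) \<noteq> 0" and e: "herm_mult e e = e" and nonscalar: "\<And>\<alpha>. e \<noteq> herm_scalar \<alpha>"
  shows "herm_trace e = 1 \<or> herm_trace e = 2"
proof -
  obtain \<alpha> \<beta> \<gamma> a b c where x: "e = Herm \<alpha> \<beta> \<gamma> a b c" by (cases e)
  define p q r where "p = 1 - \<alpha> - \<beta>" and "q = 1 - \<alpha> - \<gamma>" and "r = 1 - \<beta> - \<gamma>"
  have mult_e: "herm_mult e e = Herm (\<alpha> * \<alpha> + oct_norm a + oct_norm b) (\<beta> * \<beta> + oct_norm a + oct_norm c)
      (\<gamma> * \<gamma> + oct_norm b + oct_norm c) (oct_scale (\<alpha> + \<beta>) a + b \<star> oct_conj c)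
      (oct_scale (\<alpha> + \<gamma>) b + a \<star> c) (oct_scale (\<beta> + \<gamma>) c + oct_conj a \<star> b)" (is "_ = ?e2")
  proof -
    have "y + y + z + z = oct_scale 2 (y + z)" for y z :: "'a oct"
      by (simp add: oct_coords algebra_simps)
    then have "herm_anticomm e e = herm_scale 2 ?e2"
      by (simp add: x oct_inner_self distrib_left)
    then show ?thesis using two by (simp add: herm_mult_def oct_linear)
  qed
  have diag: "\<alpha> * \<alpha> + oct_norm a + oct_norm b = \<alpha>" "\<beta> * \<beta> + oct_norm a + oct_norm c = \<beta>"
    "\<gamma> * \<gamma> + oct_norm b + oct_norm c = \<gamma>"
    and off: "oct_scale (\<alpha> + \<beta>) a + b \<star> oct_conj c = a" "oct_scale (\<alpha> + \<gamma>) b + a \<star> c = b"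
    "oct_scale (\<beta> + \<gamma>) c + oct_conj a \<star> b = c"
    using e mult_e by (simp_all add: x)
  have off': "b \<star> oct_conj c = oct_scale p a" "a \<star> c = oct_scale q b" "oct_conj a \<star> b = oct_scale r c"
    using off by (simp_all add: p_def q_def r_def oct_linear algebra_simps)
  have off'': "c \<star> oct_conj b = oct_scale p (oct_conj a)" "oct_conj b \<star> a = oct_scale r (oct_conj c)"
    using arg_cong[OF off'(1), of oct_conj] arg_cong[OF off'(3), of oct_conj]
    by (simp_all add: oct_linear oct_conj_mult)
  have eqs: "oct_scale (oct_norm c) a = oct_scale (p * q) a" "oct_scale (oct_norm b) a = oct_scale (p * r) a"
    "oct_scale (oct_norm c) b = oct_scale (p * q) b" "oct_scale (oct_norm a) b = oct_scale (q * r) b"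
    "oct_scale (oct_norm a) c = oct_scale (q * r) c" "oct_scale (oct_norm b) c = oct_scale (p * r) c"
    using oct_right_cancel(1)[of a c] oct_right_cancel(2)[of b c]
      oct_left_cancel(1)[of a b] oct_left_cancel(2)[of a c]
      oct_left_cancel(1)[of b a] oct_right_cancel(2)[of c b]
    by (simp_all add: off' off'' oct_linear mult.commute)
  have norms: "a \<noteq> 0 \<Longrightarrow> oct_norm c = p * q \<and> oct_norm b = p * r"
    "b \<noteq> 0 \<Longrightarrow> oct_norm c = p * q \<and> oct_norm a = q * r"
    "c \<noteq> 0 \<Longrightarrow> oct_norm a = q * r \<and> oct_norm b = p * r"
    using eqs by (auto simp: oct_scale_cancel_right)
  have all: "(herm_trace e - 1) * (herm_trace e - 2) = 0" if "oct_norm a = q * r" "oct_norm b = p * r"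
  proof -
    have "(herm_trace e - 1) * (herm_trace e - 2) = \<alpha> * \<alpha> + q * r + p * r - \<alpha>"
      by (simp add: x p_def q_def r_def algebra_simps)
    then show ?thesis using diag(1) that by simp
  qed
  have idem: "x = 0 \<or> x = 1" if "x * x = x" for x :: 'a
    using that by simp
  consider "oct_norm a = q * r" "oct_norm b = p * r" | "b = 0" "c = 0" "a \<noteq> 0"
    | "a = 0" "c = 0" "b \<noteq> 0" | "a = 0" "b = 0" "c \<noteq> 0" | "a = 0" "b = 0" "c = 0"
    using norms by blast
  then show ?thesis
  proof cases
    case 1
    then show ?thesis using all by simp
  next
    case 2
    then have "p = 0" using off'(1) oct_scale_eq_0_iff[of p a] by (simp add: oct_linear)
    then have "\<beta> = 1 - \<alpha>" by (simp add: p_def)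
    moreover have "\<gamma> = 0 \<or> \<gamma> = 1" using diag(3) 2 by (simp add: oct_norm_zero)
    ultimately show ?thesis by (auto simp: x)
  next
    case 3
    then have "q = 0" using off'(2) oct_scale_eq_0_iff[of q b] by (simp add: oct_linear)
    then have "\<gamma> = 1 - \<alpha>" by (simp add: q_def)
    moreover have "\<beta> = 0 \<or> \<beta> = 1" using diag(2) 3 by (simp add: oct_norm_zero)
    ultimately show ?thesis by (auto simp: x)
  next
    case 4
    then have "r = 0" using off'(3) oct_scale_eq_0_iff[of r c] by (simp add: oct_linear)
    then have "\<gamma> = 1 - \<beta>" by (simp add: r_def)
    moreover have "\<alpha> = 0 \<or> \<alpha> = 1" using diag(1) 4 by (simp add: oct_norm_zero)
    ultimately show ?thesis by (auto simp: x)
  next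
    case 5
    then have "\<alpha> = 0 \<or> \<alpha> = 1" "\<beta> = 0 \<or> \<beta> = 1" "\<gamma> = 0 \<or> \<gamma> = 1"
      using diag by (simp_all add: oct_norm_zero)
    then show ?thesis using nonscalar[of \<alpha>] 5 by (auto simp: x herm_scalar_def)
  qed
qed

text \<open>
  The trace of \<open>(y \<circ> e) \<circ> e = \<alpha> e\<close> is \<open>\<alpha> tr(e)\<close>, and by associativity of the trace form it is also the
  trace \<open>3 \<alpha>\<close> of \<open>y \<circ> e\<close>.
\<close>

lemma herm_mult_idempotent_scalar:
  fixes y e :: "'a::field herm"
  assumes two: "(2::'a) \<noteq> 0" and e: "herm_mult e e = e" and nonscalar: "\<And>\<alpha>. e \<noteq> herm_scalar \<alpha>"
    and y: "herm_mult y e = herm_scalar \<alpha>"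
  shows "\<alpha> = 0"
proof -
  have "\<alpha> * herm_trace e = herm_trace (herm_mult (herm_mult y e) e)"
    by (simp add: y herm_mult_scalar[OF two] herm_trace_scale)
  also have "\<dots> = \<alpha> + \<alpha> + \<alpha>"
    by (simp only: herm_trace_assoc e) (simp add: y herm_scalar_def)
  finally have "\<alpha> * (herm_trace e - 3) = 0" by (simp add: algebra_simps)
  moreover have "herm_trace e - 3 = - 2 \<or> herm_trace e - 3 = - 1"
    using herm_idempotent_trace[OF two e nonscalar] by auto
  then have "herm_trace e - 3 \<noteq> 0"
    using two by (metis neg_equal_0_iff_equal zero_neq_one)
  ultimately show ?thesis by simp
qed

lemma herm_word_scalar:
  fixes \<alpha> :: "'a::field"
  assumes two: "(2::'a) \<noteq> 0"
  shows "es \<noteq> [] \<Longrightarrow> set es \<subseteq> idempotents UNIV herm_mult \<Longrightarrow> word_value herm_mult es = herm_scalar \<alpha>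
    \<Longrightarrow> \<alpha> = 0 \<or> \<alpha> = 1"
proof (induction es rule: rev_nonempty_induct)
  have idem: "\<alpha> = 0 \<or> \<alpha> = 1" if "herm_mult (herm_scalar \<alpha>) (herm_scalar \<alpha>) = herm_scalar \<alpha>" for \<alpha> :: 'a
    using that by (simp add: herm_mult_scalar[OF two]) (simp add: herm_scalar_def)
  {
    case (single e)
    then show ?case using idem by (simp add: word_value_def idempotents_def)
  next
    case (snoc e es)
    then have e: "herm_mult e e = e" and y: "herm_mult (word_value herm_mult es) e = herm_scalar \<alpha>"
      by (simp_all add: word_value_snoc idempotents_def)
    show ?case
    proof (cases "\<exists>\<beta>. e = herm_scalar \<beta>")
      case True
      then obtain \<beta> where \<beta>: "e = herm_scalar \<beta>" by blast
      then have "\<beta> = 0 \<or> \<beta> = 1" using e idem by blast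
      then show ?thesis
      proof
        assume "\<beta> = 0"
        then have "herm_scale 0 (word_value herm_mult es) = herm_scalar \<alpha>"
          using y \<beta> by (simp add: herm_mult_scalar[OF two])
        then show ?thesis by (cases "word_value herm_mult es") (simp add: herm_scalar_def)
      next
        assume "\<beta> = 1"
        then have "herm_scale 1 (word_value herm_mult es) = herm_scalar \<alpha>"
          using y \<beta> by (simp add: herm_mult_scalar[OF two])
        then have "word_value herm_mult es = herm_scalar \<alpha>"
          by (cases "word_value herm_mult es") (simp add: oct_scale_one)
        then show ?thesis using snoc by simp
      qed
    next
      case False
      then show ?thesis using herm_mult_idempotent_scalar[OF two e _ y] by blast
    qed
  }
qed

section \<open>Transfer to matrices\<close>

fun herm_matrix :: "'a::field herm \<Rightarrow> 'a octmat" where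
  "herm_matrix (Herm \<alpha> \<beta> \<gamma> a b c) =
    vector [vector [oct_of_scalar \<alpha>, a, b],
            vector [oct_conj a, oct_of_scalar \<beta>, c],
            vector [oct_conj b, oct_conj c, oct_of_scalar \<gamma>]]"

lemma albert_eq_range: "albert = range herm_matrix"
proof (intro set_eqI iffI)
  fix X :: "'a octmat"
  assume "X \<in> albert"
  then obtain \<alpha> \<beta> \<gamma> a b c where "X = herm_matrix (Herm \<alpha> \<beta> \<gamma> a b c)"
    unfolding albert_def herm_matrix.simps by blast
  then show "X \<in> range herm_matrix" by (rule range_eqI)
next
  fix X :: "'a octmat"
  assume "X \<in> range herm_matrix"
  then obtain x where x: "X = herm_matrix x" by blast
  then show "X \<in> albert" unfolding albert_def by (cases x) (simp only: herm_matrix.simps, blast)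
qed

lemma herm_matrix_inj: "herm_matrix x = herm_matrix y \<longleftrightarrow> x = y"
  by (cases x; cases y) (auto simp: vec_eq_iff[where 'b = 3] forall_3 oct_of_scalar_def mat_def forall_2 vec_eq_iff)

lemma herm_matrix_scale: "herm_matrix (herm_scale r x) = octmat_scale r (herm_matrix x)"
  by (cases x) (simp add: vec_eq_iff forall_3 octmat_scale_def map_matrix_def oct_conj_scale, simp add: oct_coords)

lemma herm_matrix_anticomm:
  "herm_matrix (herm_anticomm x y) =
    octmat_mult (herm_matrix x) (herm_matrix y) + octmat_mult (herm_matrix y) (herm_matrix x)"
  by (cases x; cases y; simp add: vec_eq_iff[where 'b = 3] forall_3 octmat_mult_def sum_3;
      simp add: oct_coords algebra_simps)

lemma herm_matrix_mult: "herm_matrix (herm_mult x y) = albert_mult (herm_matrix x) (herm_matrix y)"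
  by (simp add: herm_mult_def albert_mult_def herm_matrix_scale herm_matrix_anticomm)

lemma herm_matrix_scalar: "herm_matrix (herm_scalar \<alpha>) = octmat_scale \<alpha> albert_one"
  by (simp add: herm_scalar_def vec_eq_iff[where 'b = 3] forall_3 octmat_scale_def map_matrix_def
      albert_one_def mat_def) (simp add: oct_coords)

lemma within_words_albert:
  assumes "short_word k x" shows "within_words albert albert_mult k (herm_matrix x)"
  by (rule within_words_image[OF assms]) (auto simp: albert_eq_range herm_matrix_mult)

lemma albert_words_lift:
  assumes "idempotent_word albert albert_mult es"
  obtains fs where "idempotent_word UNIV herm_mult fs" "es = map herm_matrix fs"
    "word_value albert_mult es = herm_matrix (word_value herm_mult fs)"
proof -
  have "set es \<subseteq> range herm_matrix"
    using assms by (auto simp: idempotent_word_def idempotents_def albert_eq_range)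
  then obtain fs where es: "es = map herm_matrix fs"
    using ex_map_conv[of es herm_matrix] by blast
  have "fs \<noteq> []" using assms es by (auto simp: idempotent_word_def)
  then have "word_value albert_mult es = herm_matrix (word_value herm_mult fs)"
    using word_value_map[of fs UNIV herm_matrix herm_mult albert_mult] es by (simp add: herm_matrix_mult)
  moreover have "idempotent_word UNIV herm_mult fs"
    using assms \<open>fs \<noteq> []\<close> unfolding es idempotent_word_def idempotents_def
    by (auto simp: herm_matrix_inj simp flip: herm_matrix_mult)
  ultimately show ?thesis using that es by blast
qed

lemma within_words_value: "within_words A p k x \<Longrightarrow> x \<in> idempotent_word_values A p"
  unfolding within_words_def idempotent_word_values_def by blast

lemma idempotent_width_le:
  assumes "\<And>x. x \<in> idempotent_word_values A p \<Longrightarrow> within_words A p k x"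
  shows "idempotent_width A p \<le> enat k"
  unfolding idempotent_width_def
proof (rule SUP_least)
  fix x assume "x \<in> idempotent_word_values A p"
  then obtain es where es: "idempotent_word A p es" "word_value p es = x" "length es \<le> k"
    using assms unfolding within_words_def by blast
  then have "idempotent_word_length A p x \<le> length es"
    unfolding idempotent_word_length_def by (intro Least_le) blast
  then show "enat (idempotent_word_length A p x) \<le> enat k" using es(3) by simp
qed

theorem proposition6p4:
  assumes "CHAR('a::field) \<noteq> 2"
  shows "idempotent_word_values (albert :: 'a octmat set) albert_mult =
           (albert - {octmat_scale \<alpha> albert_one |\<alpha>. True}) \<union> {0, albert_one}
       \<and> idempotent_width (albert :: 'a octmat set) albert_mult \<le> 10
       \<and> (quadratically_closed TYPE('a) \<longrightarrow>
            idempotent_width (albert :: 'a octmat set) albert_mult \<le> 7)"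
proof -
  have two: "(2::'a) \<noteq> 0"
  proof
    assume "(2::'a) = 0"
    then have "CHAR('a) dvd 2" using of_nat_eq_0_iff_char_dvd[where 'a = 'a, of 2] by simp
    then have "CHAR('a) = 1 \<or> CHAR('a) = 2"
      using two_is_prime_nat unfolding prime_nat_iff by blast
    then show False using assms by simp
  qed
  have scalar01: "herm_matrix (herm_scalar 0) = (0 :: 'a octmat)"
      "herm_matrix (herm_scalar 1) = (albert_one :: 'a octmat)"
    by (simp_all add: herm_matrix_scalar octmat_scale_def map_matrix_def vec_eq_iff oct_linear)
  have short: "within_words albert albert_mult 7 X"
    if X: "X \<in> (albert - {octmat_scale \<alpha> albert_one |\<alpha>. True}) \<union> {0, albert_one}" for X :: "'a octmat"
  proof (cases "X = 0 \<or> X = albert_one")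
    case True
    have "short_word (Suc 6) (herm_scalar (0::'a))" "short_word (Suc 6) (herm_scalar (1::'a))"
      unfolding herm_scalar_def by (intro within_words_idempotent herm_idempotent_diag two; simp)+
    then show ?thesis using True within_words_albert[of 7] by (auto simp flip: scalar01)
  next
    case False
    then obtain x where x: "X = herm_matrix x" "\<And>\<alpha>. x \<noteq> herm_scalar \<alpha>"
      using X by (auto simp: albert_eq_range simp flip: herm_matrix_scalar)
    then have "short_word 7 x"
      by (cases x) (auto simp: herm_scalar_def intro!: short_word_nonscalar[OF two])
    then show ?thesis using x within_words_albert by blast
  qed
  have long: "X \<in> (albert - {octmat_scale \<alpha> albert_one |\<alpha>. True}) \<union> {0, albert_one}"
    if X: "X \<in> idempotent_word_values albert albert_mult" for X :: "'a octmat"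
  proof -
    obtain fs where fs: "idempotent_word UNIV herm_mult fs" "X = herm_matrix (word_value herm_mult fs)"
      using X albert_words_lift unfolding idempotent_word_values_def by blast
    have "\<alpha> = 0 \<or> \<alpha> = 1" if "X = octmat_scale \<alpha> albert_one" for \<alpha>
      using herm_word_scalar[OF two, of fs \<alpha>] fs that
      by (simp add: idempotent_word_def herm_matrix_inj flip: herm_matrix_scalar)
    moreover have "X \<in> albert" using fs(2) by (simp add: albert_eq_range)
    ultimately show ?thesis
      using scalar01 herm_matrix_scalar[where 'a = 'a] by (cases "\<exists>\<alpha>. X = octmat_scale \<alpha> albert_one") auto
  qed
  have "idempotent_word_values (albert :: 'a octmat set) albert_mult =
      (albert - {octmat_scale \<alpha> albert_one |\<alpha>. True}) \<union> {0, albert_one}"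
    by (rule set_eqI, rule iffI, erule long, erule within_words_value[OF short])
  moreover have "idempotent_width (albert :: 'a octmat set) albert_mult \<le> enat 7"
    by (rule idempotent_width_le, rule short, erule long)
  then have "idempotent_width (albert :: 'a octmat set) albert_mult \<le> 7"
    by (simp add: numeral_eq_enat)
  moreover from this have "idempotent_width (albert :: 'a octmat set) albert_mult \<le> 10"
    by (rule order_trans) simp
  ultimately show ?thesis by (intro conjI impI)
qed

end
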